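(* Let $\mathbf{MSLat}$ be the category of meet-semilattices (with top element) and maps preserving finite meets. Let $\mathbf{SCLoc}$ be the category whose objects are the locales which have a basis of supercompact elements which is closed under finite meets and whose arrows are the locale morphisms whose associated frame homomorphisms send supercompact elements to supercompact elements. Let $A:\mathbf{MSLat}^{\mathrm{op}}\to\mathbf{SCLoc}$ be the functor sending $\mathcal{M}$ to the locale whose frame is the set $\mathrm{Id}(\mathcal{M})$ of lower sets of $\mathcal{M}$ ordered by inclusion, and $f:\mathcal{M}\to\mathcal{N}$ to the locale morphism whose frame homomorphism $\mathrm{Id}(\mathcal{M})\to \mathrm{Id}(\mathcal{N})$ sends a lower set $S$ to the lower set generated by $f(S)$. Let $I_A:\mathbf{SCLoc}\to\mathbf{MSLat}^{\mathrm{op}}$ be the functor sending $L$ to the poset of its supercompact elements (with the induced order) and a locale morphism $L\to L'$ to the restriction of its associated frame homomorphism to the subsets of supercompact elements. Then $A$ and $I_A$ yield a duality between $\mathbf{MSLat}$ and $\mathbf{SCLoc}$.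
   Context: An element $a$ of a frame (or locale) is supercompact if whenever $a=\bigvee_{i\in I}a_i$ ($I$ possibly empty) there is $i\in I$ with $a=a_i$. A basis of a locale $L$ is a subset $B$ such that every element of $L$ is a join of elements of $B$. Finite meets include the empty meet (the top element). A locale morphism $L\to L'$ corresponds to a frame homomorphism from the frame of $L'$ to the frame of $L$. *)

theory Defs
  imports "HOL-Algebra.Complete_Lattice" "HOL-Library.FuncSet"
begin

section \<open>Categories\<close>

text \<open>
  A category is given by a set of objects and a family of (not necessarily disjoint) hom-sets.
  Composition therefore takes the three objects involved as arguments:
  \<open>Comp C X Y Z g f\<close> is the composite of \<open>f : X \<rightarrow> Y\<close> followed by \<open>g : Y \<rightarrow> Z\<close>.
\<close>

record ('o, 'm) cat_data =
  Obj :: "'o set"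
  Hom :: "'o \<Rightarrow> 'o \<Rightarrow> 'm set"
  Ident :: "'o \<Rightarrow> 'm"
  Comp :: "'o \<Rightarrow> 'o \<Rightarrow> 'o \<Rightarrow> 'm \<Rightarrow> 'm \<Rightarrow> 'm"

locale category =
  fixes C :: "('o, 'm) cat_data"
  assumes ident_in_hom: "X \<in> Obj C \<Longrightarrow> Ident C X \<in> Hom C X X"
    and comp_in_hom:
      "\<lbrakk>X \<in> Obj C; Y \<in> Obj C; Z \<in> Obj C; f \<in> Hom C X Y; g \<in> Hom C Y Z\<rbrakk>
        \<Longrightarrow> Comp C X Y Z g f \<in> Hom C X Z"
    and ident_right:
      "\<lbrakk>X \<in> Obj C; Y \<in> Obj C; f \<in> Hom C X Y\<rbrakk> \<Longrightarrow> Comp C X X Y f (Ident C X) = f"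
    and ident_left:
      "\<lbrakk>X \<in> Obj C; Y \<in> Obj C; f \<in> Hom C X Y\<rbrakk> \<Longrightarrow> Comp C X Y Y (Ident C Y) f = f"
    and comp_assoc:
      "\<lbrakk>W \<in> Obj C; X \<in> Obj C; Y \<in> Obj C; Z \<in> Obj C;
        f \<in> Hom C W X; g \<in> Hom C X Y; h \<in> Hom C Y Z\<rbrakk>
        \<Longrightarrow> Comp C W X Z (Comp C X Y Z h g) f = Comp C W Y Z h (Comp C W X Y g f)"

definition opposite :: "('o, 'm) cat_data \<Rightarrow> ('o, 'm) cat_data" where
  "opposite C =
     \<lparr>Obj = Obj C, Hom = (\<lambda>X Y. Hom C Y X), Ident = Ident C,
      Comp = (\<lambda>X Y Z g f. Comp C Z Y X f g)\<rparr>"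

definition iso_in :: "('o, 'm) cat_data \<Rightarrow> 'o \<Rightarrow> 'o \<Rightarrow> 'm \<Rightarrow> bool" where
  "iso_in C X Y f \<longleftrightarrow> f \<in> Hom C X Y \<and>
     (\<exists>g \<in> Hom C Y X. Comp C X Y X g f = Ident C X \<and> Comp C Y X Y f g = Ident C Y)"

text \<open>\<open>ArrMap F X Y f\<close> is the image of \<open>f : X \<rightarrow> Y\<close>.\<close>

record ('o, 'm, 'p, 'n) functor_data =
  ObjMap :: "'o \<Rightarrow> 'p"
  ArrMap :: "'o \<Rightarrow> 'o \<Rightarrow> 'm \<Rightarrow> 'n"

locale is_functor = source: category C + target: category D
  for C :: "('o, 'm) cat_data" and D :: "('p, 'n) cat_data" +
  fixes F :: "('o, 'm, 'p, 'n) functor_data"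
  assumes obj_map: "X \<in> Obj C \<Longrightarrow> ObjMap F X \<in> Obj D"
    and arr_map:
      "\<lbrakk>X \<in> Obj C; Y \<in> Obj C; f \<in> Hom C X Y\<rbrakk>
        \<Longrightarrow> ArrMap F X Y f \<in> Hom D (ObjMap F X) (ObjMap F Y)"
    and map_ident: "X \<in> Obj C \<Longrightarrow> ArrMap F X X (Ident C X) = Ident D (ObjMap F X)"
    and map_comp:
      "\<lbrakk>X \<in> Obj C; Y \<in> Obj C; Z \<in> Obj C; f \<in> Hom C X Y; g \<in> Hom C Y Z\<rbrakk>
        \<Longrightarrow> ArrMap F X Z (Comp C X Y Z g f) =
            Comp D (ObjMap F X) (ObjMap F Y) (ObjMap F Z) (ArrMap F Y Z g) (ArrMap F X Y f)"

definition id_functor :: "('o, 'm, 'o, 'm) functor_data" where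
  "id_functor = \<lparr>ObjMap = (\<lambda>X. X), ArrMap = (\<lambda>X Y f. f)\<rparr>"

definition comp_functor ::
  "('p, 'n, 'q, 'k) functor_data \<Rightarrow> ('o, 'm, 'p, 'n) functor_data \<Rightarrow> ('o, 'm, 'q, 'k) functor_data"
  (infixr \<open>\<circ>\<^sub>F\<close> 55) where
  "G \<circ>\<^sub>F F =
     \<lparr>ObjMap = (\<lambda>X. ObjMap G (ObjMap F X)),
      ArrMap = (\<lambda>X Y f. ArrMap G (ObjMap F X) (ObjMap F Y) (ArrMap F X Y f))\<rparr>"

definition natural_iso ::
  "('o, 'm) cat_data \<Rightarrow> ('p, 'n) cat_data \<Rightarrow>
   ('o, 'm, 'p, 'n) functor_data \<Rightarrow> ('o, 'm, 'p, 'n) functor_data \<Rightarrow> ('o \<Rightarrow> 'n) \<Rightarrow> bool" where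
  "natural_iso C D F G \<eta> \<longleftrightarrow>
     is_functor C D F \<and> is_functor C D G \<and>
     (\<forall>X \<in> Obj C. iso_in D (ObjMap F X) (ObjMap G X) (\<eta> X)) \<and>
     (\<forall>X \<in> Obj C. \<forall>Y \<in> Obj C. \<forall>f \<in> Hom C X Y.
        Comp D (ObjMap F X) (ObjMap F Y) (ObjMap G Y) (\<eta> Y) (ArrMap F X Y f) =
        Comp D (ObjMap F X) (ObjMap G X) (ObjMap G Y) (ArrMap G X Y f) (\<eta> X))"

definition naturally_isomorphic ::
  "('o, 'm) cat_data \<Rightarrow> ('p, 'n) cat_data \<Rightarrow>
   ('o, 'm, 'p, 'n) functor_data \<Rightarrow> ('o, 'm, 'p, 'n) functor_data \<Rightarrow> bool" where
  "naturally_isomorphic C D F G \<longleftrightarrow> (\<exists>\<eta>. natural_iso C D F G \<eta>)"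

definition equivalence_of_categories ::
  "('o, 'm) cat_data \<Rightarrow> ('p, 'n) cat_data \<Rightarrow>
   ('o, 'm, 'p, 'n) functor_data \<Rightarrow> ('p, 'n, 'o, 'm) functor_data \<Rightarrow> bool" where
  "equivalence_of_categories C D F G \<longleftrightarrow>
     is_functor C D F \<and> is_functor D C G \<and>
     naturally_isomorphic C C id_functor (G \<circ>\<^sub>F F) \<and>
     naturally_isomorphic D D (F \<circ>\<^sub>F G) id_functor"

definition duality ::
  "('o, 'm) cat_data \<Rightarrow> ('p, 'n) cat_data \<Rightarrow>
   ('o, 'm, 'p, 'n) functor_data \<Rightarrow> ('p, 'n, 'o, 'm) functor_data \<Rightarrow> bool" where
  "duality C D F G \<longleftrightarrow> equivalence_of_categories (opposite C) D F G"


section \<open>Meet-semilattices and frames\<close>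

locale meet_semilattice = lower_semilattice L + weak_partial_order_top L
  for L :: "'a gorder" (structure)

locale frame = complete_lattice L for L :: "'a gorder" (structure) +
  assumes meet_sup_distrib:
    "\<lbrakk>x \<in> carrier L; S \<subseteq> carrier L\<rbrakk> \<Longrightarrow> x \<sqinter> \<Squnion>S = \<Squnion>((\<lambda>s. x \<sqinter> s) ` S)"

text \<open>The case \<open>F = {}\<close> is preservation of the top element.\<close>

definition finite_meet_pres :: "'a gorder \<Rightarrow> 'b gorder \<Rightarrow> ('a \<Rightarrow> 'b) \<Rightarrow> bool" where
  "finite_meet_pres M N f \<longleftrightarrow>
     (\<forall>F. finite F \<and> F \<subseteq> carrier M \<longrightarrow> f (\<Sqinter>\<^bsub>M\<^esub>F) = \<Sqinter>\<^bsub>N\<^esub>(f ` F))"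

text \<open>
  Arrows are functions on the carrier, represented extensionally so that equality of arrows is
  equality of functions.
\<close>

definition mslat_hom :: "'a gorder \<Rightarrow> 'b gorder \<Rightarrow> ('a \<Rightarrow> 'b) set" where
  "mslat_hom M N = {f \<in> carrier M \<rightarrow>\<^sub>E carrier N. finite_meet_pres M N f}"

definition frame_hom :: "'a gorder \<Rightarrow> 'b gorder \<Rightarrow> ('a \<Rightarrow> 'b) set" where
  "frame_hom L L' =
     {f \<in> carrier L \<rightarrow>\<^sub>E carrier L'. finite_meet_pres L L' f \<and> sup_pres L L' f}"

text \<open>
  A family \<open>a\<^sub>i\<close> enters the definition of supercompactness only through its set of values \<open>S\<close>;
  the choice \<open>S = {}\<close> excludes the bottom element.
\<close>

definition supercompact :: "'a gorder \<Rightarrow> 'a \<Rightarrow> bool" where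
  "supercompact L a \<longleftrightarrow>
     a \<in> carrier L \<and> (\<forall>S. S \<subseteq> carrier L \<and> a = \<Squnion>\<^bsub>L\<^esub>S \<longrightarrow> a \<in> S)"

definition supercompacts :: "'a gorder \<Rightarrow> 'a set" where
  "supercompacts L = {a. supercompact L a}"

definition is_basis :: "'a gorder \<Rightarrow> 'a set \<Rightarrow> bool" where
  "is_basis L B \<longleftrightarrow>
     B \<subseteq> carrier L \<and> (\<forall>x \<in> carrier L. \<exists>S. S \<subseteq> B \<and> x = \<Squnion>\<^bsub>L\<^esub>S)"

definition finite_meet_closed :: "'a gorder \<Rightarrow> 'a set \<Rightarrow> bool" where
  "finite_meet_closed L B \<longleftrightarrow> (\<forall>F. finite F \<and> F \<subseteq> B \<longrightarrow> \<Sqinter>\<^bsub>L\<^esub>F \<in> B)"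

definition has_supercompact_basis :: "'a gorder \<Rightarrow> bool" where
  "has_supercompact_basis L \<longleftrightarrow>
     (\<exists>B. is_basis L B \<and> B \<subseteq> supercompacts L \<and> finite_meet_closed L B)"


section \<open>The two categories\<close>

text \<open>
  A HOL type cannot contain \<^emph>\<open>all\<close> meet-semilattices, so the categories are formed from the objects
  whose carrier lies in a given collection \<open>K\<close> of subsets of a type.  With \<open>K = UNIV\<close>
  every object over that type is admitted.
\<close>

definition concrete_category ::
  "'a gorder set \<Rightarrow> ('a gorder \<Rightarrow> 'a gorder \<Rightarrow> ('a \<Rightarrow> 'a) set) \<Rightarrow> ('a gorder, 'a \<Rightarrow> 'a) cat_data" where
  "concrete_category Ob H =
     \<lparr>Obj = Ob, Hom = H, Ident = (\<lambda>X. \<lambda>x \<in> carrier X. x),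
      Comp = (\<lambda>X Y Z g f. compose (carrier X) g f)\<rparr>"

definition MSLat :: "'a set set \<Rightarrow> ('a gorder, 'a \<Rightarrow> 'a) cat_data" where
  "MSLat K = concrete_category {M. meet_semilattice M \<and> carrier M \<in> K} mslat_hom"

text \<open>
  A locale is represented by its frame, and a locale morphism \<open>L \<rightarrow> L'\<close> by its frame homomorphism
  from the frame of \<open>L'\<close> to the frame of \<open>L\<close>.
\<close>

definition SCFrm :: "'a set set \<Rightarrow> ('a gorder, 'a \<Rightarrow> 'a) cat_data" where
  "SCFrm K = concrete_category {L. frame L \<and> has_supercompact_basis L \<and> carrier L \<in> K}
     (\<lambda>L L'. {f \<in> frame_hom L L'. \<forall>a. supercompact L a \<longrightarrow> supercompact L' (f a)})"

definition SCLoc :: "'a set set \<Rightarrow> ('a gorder, 'a \<Rightarrow> 'a) cat_data" where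
  "SCLoc K = opposite (SCFrm K)"


section \<open>The two functors\<close>

definition lower_sets :: "'a gorder \<Rightarrow> 'a set set" where
  "lower_sets M = {S. S \<subseteq> carrier M \<and> (\<forall>x \<in> S. \<forall>y \<in> carrier M. y \<sqsubseteq>\<^bsub>M\<^esub> x \<longrightarrow> y \<in> S)}"

definition lower_closure :: "'a gorder \<Rightarrow> 'a set \<Rightarrow> 'a set" where
  "lower_closure M T = {y \<in> carrier M. \<exists>x \<in> T. y \<sqsubseteq>\<^bsub>M\<^esub> x}"

definition Id_frame :: "'a gorder \<Rightarrow> 'a set gorder" where
  "Id_frame M = \<lparr>carrier = lower_sets M, eq = (=), le = (\<subseteq>)\<rparr>"

text \<open>
  An arrow \<open>N \<rightarrow> M\<close> of the opposite of \<open>MSLat\<close> is a map \<open>f : M \<rightarrow> N\<close>; its image is the locale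
  morphism from the locale of \<open>N\<close> to that of \<open>M\<close> given by the frame homomorphism below.
\<close>

definition A_functor :: "('a gorder, 'a \<Rightarrow> 'a, 'a set gorder, 'a set \<Rightarrow> 'a set) functor_data" where
  "A_functor =
     \<lparr>ObjMap = Id_frame,
      ArrMap = (\<lambda>N M f. \<lambda>S \<in> lower_sets M. lower_closure N (f ` S))\<rparr>"

definition I_functor :: "('a gorder, 'a \<Rightarrow> 'a, 'a gorder, 'a \<Rightarrow> 'a) functor_data" where
  "I_functor =
     \<lparr>ObjMap = (\<lambda>L. L\<lparr>carrier := supercompacts L\<rparr>),
      ArrMap = (\<lambda>L L' f. restrict f (supercompacts L'))\<rparr>"


section \<open>Change of carrier\<close>

text \<open>
  The lower sets of a meet-semilattice over \<open>'a\<close> have type \<open>'a set\<close>, so \<open>A_functor\<close> changes the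
  type over which objects live.  Transport of an ordered set along a map \<open>e\<close> injective on its carrier
  gives an isomorphic copy over another type.
\<close>

definition relabel :: "('a \<Rightarrow> 'b) \<Rightarrow> 'a gorder \<Rightarrow> 'b gorder" where
  "relabel e L =
     \<lparr>carrier = e ` carrier L, eq = (=),
      le = (\<lambda>x y. the_inv_into (carrier L) e x \<sqsubseteq>\<^bsub>L\<^esub> the_inv_into (carrier L) e y)\<rparr>"

definition relabel_map :: "('a \<Rightarrow> 'b) \<Rightarrow> 'a gorder \<Rightarrow> 'a gorder \<Rightarrow> ('a \<Rightarrow> 'a) \<Rightarrow> 'b \<Rightarrow> 'b" where
  "relabel_map e L L' f = (\<lambda>y \<in> e ` carrier L. e (f (the_inv_into (carrier L) e y)))"

text \<open>
  For use on \<open>opposite (MSLat K)\<close> and on \<open>SCLoc K\<close>: in both, an arrow \<open>L \<rightarrow> L'\<close> is a function from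
  the carrier of \<open>L'\<close> to the carrier of \<open>L\<close>.
\<close>

definition relabel_functor ::
  "('a \<Rightarrow> 'b) \<Rightarrow> ('a gorder, 'a \<Rightarrow> 'a, 'b gorder, 'b \<Rightarrow> 'b) functor_data" where
  "relabel_functor e =
     \<lparr>ObjMap = relabel e, ArrMap = (\<lambda>L L' f. relabel_map e L' L f)\<rparr>"

text \<open>
  A universe inside one type: a collection \<open>K\<close> of ``small'' sets closed under subsets and, up to an
  injective encoding of small sets as elements, under power sets.  Every Grothendieck universe, with
  \<open>code\<close> the passage from a small collection of elements to the set it forms, is of this kind.
\<close>

definition universe :: "'u set set \<Rightarrow> ('u set \<Rightarrow> 'u) \<Rightarrow> bool" where
  "universe K code \<longleftrightarrow>
     inj_on code K \<and>
     (\<forall>X \<in> K. \<forall>Y. Y \<subseteq> X \<longrightarrow> Y \<in> K) \<and>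
     (\<forall>X \<in> K. code ` Pow X \<in> K)"

end

theory Submission
  imports Defs
begin

text \<open>
  Everything rests on two order isomorphisms.  Below, \<open>\<down>\<close> denotes the lower closure of a set or of a
  single element.

  For a meet-semilattice \<open>M\<close>, a lower set is the union of the principal ideals of its elements,
  and joins of lower sets are unions.  Hence a supercompact lower set is one of those principal
  ideals; conversely, a union equal to the ideal of \<open>x\<close> has a member that contains \<open>x\<close>, and this
  member is the whole ideal.  So \<open>x \<mapsto> \<down>x\<close> is an isomorphism from \<open>M\<close> onto the supercompact elements of
  its frame of lower sets (\<open>order_iso_principal_ideal\<close>).

  For a frame \<open>L\<close> with a supercompact basis closed under finite meets, every supercompact element is
  a join of basis elements and therefore equal to one of them.  So the basis consists of all
  supercompact elements, and these form a meet-semilattice whose meets are those of \<open>L\<close>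
  (\<open>supercompacts_finite_inf\<close>).  Frame distributivity makes supercompact elements completely join
  prime (\<open>supercompact_le_sup\<close>), so a lower set \<open>S\<close> of supercompact elements can be recovered from its
  join as the set of supercompact elements below \<open>\<Squnion>S\<close>.  As the supercompact elements form a basis,
  \<open>S \<mapsto> \<Squnion>S\<close> is an isomorphism from the lower sets of supercompact elements onto \<open>L\<close>
  (\<open>order_iso_sup_supercompacts\<close>).

  Naturality of the two families is \<open>\<down>f(\<down>x) = \<down>(f x)\<close>, which holds because \<open>f\<close> is monotone
  (\<open>lower_closure_image_principal_ideal\<close>), and \<open>f (\<Squnion>S) = \<Squnion>(\<down>(f ` S))\<close>, which holds because a frame
  homomorphism preserves joins and closing downwards does not change a join
  (\<open>sup_lower_closure_image\<close>).  The main point of functoriality is that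
  \<open>S \<mapsto> \<down>(f ` S)\<close> preserves finite meets (\<open>lower_closure_image_Inter\<close>), which uses that \<open>f\<close> does,
  and not merely that \<open>f\<close> is monotone.

  The change of carrier costs nothing: an injective relabelling is an order isomorphism, and an
  order isomorphism preserves every notion involved.  Each of the four natural isomorphisms is one
  of the two families above composed with a relabelling.
\<close>

section \<open>Meets, joins and order isomorphisms\<close>

lemma (in partial_order) inf_eqI: "is_glb L x F \<Longrightarrow> \<Sqinter>F = x"
  unfolding Lattice.inf_def by (rule some_equality) (auto intro: greatest_unique)

lemma (in partial_order) sup_eqI: "is_lub L x S \<Longrightarrow> \<Squnion>S = x"
  unfolding Lattice.sup_def by (rule some_equality) (auto intro: least_unique)

lemma (in meet_semilattice) finite_inf_glb:
  assumes "finite F" "F \<subseteq> carrier L"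
  shows "is_glb L (\<Sqinter>F) F"
proof (cases "F = {}")
  case True
  have "\<Sqinter>{} = \<top>"
    by (rule inf_eqI) (simp add: top_greatest)
  with True show ?thesis
    by (simp add: top_greatest)
next
  case False
  with assms show ?thesis
    by (simp add: finite_inf_greatest)
qed

lemma frame_meet_semilattice: "frame L \<Longrightarrow> meet_semilattice L"
proof -
  assume "frame L"
  then interpret frame L .
  show ?thesis
    by unfold_locales
qed

text \<open>
  Order isomorphisms between sets over possibly different types are the only comparison maps needed.
  No behaviour outside the carrier is prescribed, so that plain functions can be composed and
  inverted; arrows are obtained from them by restriction to the carrier.
\<close>

definition order_iso :: "'a gorder \<Rightarrow> 'b gorder \<Rightarrow> ('a \<Rightarrow> 'b) \<Rightarrow> bool" where
  "order_iso M N f \<longleftrightarrow>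
     bij_betw f (carrier M) (carrier N) \<and>
     (\<forall>x \<in> carrier M. \<forall>y \<in> carrier M. f x \<sqsubseteq>\<^bsub>N\<^esub> f y \<longleftrightarrow> x \<sqsubseteq>\<^bsub>M\<^esub> y)"

lemma order_iso_image: "order_iso M N f \<Longrightarrow> f ` carrier M = carrier N"
  by (simp add: order_iso_def bij_betw_def)

lemma order_iso_closed: "order_iso M N f \<Longrightarrow> x \<in> carrier M \<Longrightarrow> f x \<in> carrier N"
  by (auto simp: order_iso_def bij_betw_def)

lemma order_iso_le:
  "order_iso M N f \<Longrightarrow> x \<in> carrier M \<Longrightarrow> y \<in> carrier M \<Longrightarrow> f x \<sqsubseteq>\<^bsub>N\<^esub> f y \<longleftrightarrow> x \<sqsubseteq>\<^bsub>M\<^esub> y"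
  by (simp add: order_iso_def)

lemma order_iso_refl: "order_iso M M (\<lambda>x. x)"
  by (simp add: order_iso_def bij_betw_def)

lemma order_iso_comp: "order_iso M N f \<Longrightarrow> order_iso N P g \<Longrightarrow> order_iso M P (\<lambda>x. g (f x))"
  using bij_betw_trans[of f "carrier M" "carrier N" g "carrier P"] order_iso_closed[of M N f]
  by (simp add: order_iso_def comp_def)

lemma order_iso_inv:
  assumes f: "order_iso M N f"
  shows "order_iso N M (inv_into (carrier M) f)"
proof -
  have bij: "bij_betw f (carrier M) (carrier N)"
    using f by (simp add: order_iso_def)
  have "x \<sqsubseteq>\<^bsub>N\<^esub> y \<longleftrightarrow> inv_into (carrier M) f x \<sqsubseteq>\<^bsub>M\<^esub> inv_into (carrier M) f y"
    if "x \<in> carrier N" "y \<in> carrier N" for x y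
    using that order_iso_le[OF f, of "inv_into (carrier M) f x" "inv_into (carrier M) f y"]
      order_iso_image[OF f]
    by (simp add: inv_into_into f_inv_into_f)
  with bij_betw_inv_into[OF bij] show ?thesis
    by (simp add: order_iso_def)
qed

lemma order_iso_glb:
  assumes f: "order_iso M N f" and F: "F \<subseteq> carrier M" and x: "is_glb M x F"
  shows "is_glb N (f x) (f ` F)"
proof (rule greatest_LowerI)
  have xM: "x \<in> carrier M"
    using x by (rule greatest_closed)
  show "f ` F \<subseteq> carrier N"
    using F order_iso_image[OF f] by blast
  show "f x \<in> carrier N"
    by (rule order_iso_closed[OF f xM])
  show "f x \<sqsubseteq>\<^bsub>N\<^esub> z" if "z \<in> f ` F" for z
    using that F xM greatest_Lower_below[OF x _ F] by (auto simp: order_iso_le[OF f] subset_iff)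
  show "y \<sqsubseteq>\<^bsub>N\<^esub> f x" if y: "y \<in> Lower N (f ` F)" for y
  proof -
    have "y \<in> f ` carrier M"
      using y order_iso_image[OF f] by (auto simp: Lower_def)
    then obtain y' where y': "y' \<in> carrier M" "y = f y'"
      by blast
    have "y' \<in> Lower M F"
    proof (rule Lower_memI[OF _ y'(1)])
      fix z assume "z \<in> F"
      with F y y' have "f y' \<sqsubseteq>\<^bsub>N\<^esub> f z" "z \<in> carrier M"
        using order_iso_closed[OF f] by (auto simp: Lower_def)
      with y' show "y' \<sqsubseteq>\<^bsub>M\<^esub> z"
        by (simp add: order_iso_le[OF f])
    qed
    with x y' xM show ?thesis
      by (simp add: order_iso_le[OF f] greatest_le)
  qed
qed

lemma order_iso_dual: "order_iso M N f \<Longrightarrow> order_iso (inv_gorder M) (inv_gorder N) f"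
  by (auto simp: order_iso_def)

text \<open>
  A join is a meet in the dual order.
\<close>

lemma order_iso_lub:
  assumes "order_iso M N f" "S \<subseteq> carrier M" "is_lub M x S"
  shows "is_lub N (f x) (f ` S)"
  using order_iso_glb[OF order_iso_dual[OF assms(1)], of S x] assms(2,3) by simp

text \<open>
  The relation \<open>eq\<close> of an ordered set is not transported by a map that respects only the order; it
  has to be known to be equality on the target.
\<close>

lemma order_iso_partial_order:
  assumes f: "order_iso M N f" and M: "partial_order M" and eq: "eq N = (=)"
  shows "partial_order N"
proof -
  interpret M: partial_order M
    by (rule M)
  have N: "carrier N = f ` carrier M"
    by (simp add: order_iso_image[OF f])
  show ?thesis
  proof
    fix x y z assume "x \<in> carrier N" "y \<in> carrier N" "z \<in> carrier N"
      and "x \<sqsubseteq>\<^bsub>N\<^esub> y" "y \<sqsubseteq>\<^bsub>N\<^esub> z"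
    then show "x \<sqsubseteq>\<^bsub>N\<^esub> z"
      by (auto simp: N order_iso_le[OF f] dest: M.le_trans)
  qed (auto simp: N eq order_iso_le[OF f] dest: M.le_antisym)
qed

lemma order_iso_obtain_preimage:
  assumes "order_iso M N f" "S \<subseteq> carrier N"
  obtains T where "T \<subseteq> carrier M" "S = f ` T"
  using assms by (metis order_iso_image subset_image_iff)

lemma order_iso_finite_inf:
  assumes f: "order_iso M N f" and M: "meet_semilattice M" and N: "partial_order N"
    and F: "finite F" "F \<subseteq> carrier M"
  shows "f (\<Sqinter>\<^bsub>M\<^esub>F) = \<Sqinter>\<^bsub>N\<^esub>(f ` F)"
  using partial_order.inf_eqI[OF N order_iso_glb[OF f F(2) meet_semilattice.finite_inf_glb[OF M F]]]
  by simp

lemma order_iso_sup: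
  assumes f: "order_iso M N f" and M: "complete_lattice M" and N: "partial_order N"
    and S: "S \<subseteq> carrier M"
  shows "f (\<Squnion>\<^bsub>M\<^esub>S) = \<Squnion>\<^bsub>N\<^esub>(f ` S)"
proof -
  interpret M: complete_lattice M
    by (rule M)
  show ?thesis
    using partial_order.sup_eqI[OF N order_iso_lub[OF f S M.sup_lub[OF S]]] by simp
qed

lemma order_iso_meet_semilattice:
  assumes f: "order_iso M N f" and M: "meet_semilattice M" and eq: "eq N = (=)"
  shows "meet_semilattice N"
proof -
  interpret M: meet_semilattice M
    by (rule M)
  interpret N: partial_order N
    by (rule order_iso_partial_order[OF f _ eq]) unfold_locales
  have glb: "\<exists>i. is_glb N i F" if F: "finite F" "F \<subseteq> carrier N" for F
  proof -
    let ?G = "inv_into (carrier M) f ` F"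
    have G: "finite ?G" "?G \<subseteq> carrier M"
      using F order_iso_closed[OF order_iso_inv[OF f]] by auto
    have "f ` ?G = F"
      using F order_iso_image[OF f] by (auto simp: f_inv_into_f subset_iff image_iff)
    then show ?thesis
      using order_iso_glb[OF f G(2) M.finite_inf_glb[OF G]] by auto
  qed
  show ?thesis
    using glb[of "{}"] glb[of "{_, _}"] by unfold_locales auto
qed

lemma order_iso_complete_lattice:
  assumes f: "order_iso M N f" and M: "complete_lattice M" and eq: "eq N = (=)"
  shows "complete_lattice N"
proof -
  interpret M: complete_lattice M
    by (rule M)
  interpret N: partial_order N
    by (rule order_iso_partial_order[OF f _ eq]) unfold_locales
  show ?thesis
  proof
    fix S assume "S \<subseteq> carrier N"
    then obtain T where T: "T \<subseteq> carrier M" "S = f ` T"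
      using f by (metis order_iso_obtain_preimage)
    show "\<exists>s. is_lub N s S"
      using order_iso_lub[OF f T(1) M.sup_lub[OF T(1)]] T(2) by blast
    show "\<exists>i. is_glb N i S"
      using order_iso_glb[OF f T(1) M.inf_glb[OF T(1)]] T(2) by blast
  qed
qed

lemma order_iso_frame:
  assumes f: "order_iso M N f" and M: "frame M" and eq: "eq N = (=)"
  shows "frame N"
proof -
  interpret M: frame M
    by (rule M)
  interpret N: complete_lattice N
    by (rule order_iso_complete_lattice[OF f _ eq]) unfold_locales
  have sup: "f (\<Squnion>\<^bsub>M\<^esub>S) = \<Squnion>\<^bsub>N\<^esub>(f ` S)" if "S \<subseteq> carrier M" for S
    by (rule order_iso_sup[OF f M.complete_lattice_axioms N.partial_order_axioms that])
  have meet: "f (x \<sqinter>\<^bsub>M\<^esub> y) = f x \<sqinter>\<^bsub>N\<^esub> f y" if "x \<in> carrier M" "y \<in> carrier M" for x y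
    using order_iso_finite_inf[OF f frame_meet_semilattice[OF M] N.partial_order_axioms, of "{x, y}"]
      that by (simp add: meet_def)
  show ?thesis
  proof
    fix x S assume x: "x \<in> carrier N" and "S \<subseteq> carrier N"
    then obtain T where T: "T \<subseteq> carrier M" "S = f ` T"
      using f by (metis order_iso_obtain_preimage)
    obtain y where y: "y \<in> carrier M" "x = f y"
      using x order_iso_image[OF f] by blast
    have "x \<sqinter>\<^bsub>N\<^esub> \<Squnion>\<^bsub>N\<^esub>S = f (y \<sqinter>\<^bsub>M\<^esub> \<Squnion>\<^bsub>M\<^esub>T)"
      using T y by (simp add: sup meet)
    also have "\<dots> = \<Squnion>\<^bsub>N\<^esub>(f ` (\<lambda>t. y \<sqinter>\<^bsub>M\<^esub> t) ` T)"
      using T y by (subst M.meet_sup_distrib) (auto intro!: sup)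
    also have "f ` (\<lambda>t. y \<sqinter>\<^bsub>M\<^esub> t) ` T = (\<lambda>s. x \<sqinter>\<^bsub>N\<^esub> s) ` S"
      using T y by (auto simp: image_image meet subset_iff intro!: image_eqI)
    finally show "x \<sqinter>\<^bsub>N\<^esub> \<Squnion>\<^bsub>N\<^esub>S = \<Squnion>\<^bsub>N\<^esub>((\<lambda>s. x \<sqinter>\<^bsub>N\<^esub> s) ` S)" .
  qed
qed

lemma supercompacts_closed: "supercompacts L \<subseteq> carrier L"
  by (auto simp: supercompacts_def supercompact_def)

lemma supercompactD:
  assumes "a \<in> supercompacts L" "S \<subseteq> carrier L" "a = \<Squnion>\<^bsub>L\<^esub>S"
  shows "a \<in> S"
proof -
  have "\<forall>S. S \<subseteq> carrier L \<and> a = \<Squnion>\<^bsub>L\<^esub>S \<longrightarrow> a \<in> S"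
    using assms(1) unfolding supercompacts_def supercompact_def mem_Collect_eq by (rule conjunct2)
  from this[rule_format, OF conjI[OF assms(2,3)]] show ?thesis .
qed

lemma order_iso_supercompact:
  assumes f: "order_iso M N f" and M: "complete_lattice M" and N: "complete_lattice N"
    and a: "supercompact M a"
  shows "supercompact N (f a)"
proof -
  interpret M: complete_lattice M
    by (rule M)
  interpret N: complete_lattice N
    by (rule N)
  have aM: "a \<in> carrier M"
    using a by (simp add: supercompact_def)
  have "f a \<in> S" if S: "S \<subseteq> carrier N" "f a = \<Squnion>\<^bsub>N\<^esub>S" for S
  proof -
    obtain T where T: "T \<subseteq> carrier M" "S = f ` T"
      using f S(1) by (rule order_iso_obtain_preimage)
    have "f a = f (\<Squnion>\<^bsub>M\<^esub>T)"
      using S T order_iso_sup[OF f M N.partial_order_axioms T(1)] by simp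
    then have "a = \<Squnion>\<^bsub>M\<^esub>T"
      using f aM T by (auto simp: order_iso_def bij_betw_def dest: inj_onD)
    with a T show ?thesis
      by (auto simp: supercompact_def)
  qed
  with aM show ?thesis
    by (simp add: supercompact_def order_iso_closed[OF f])
qed

lemma order_iso_supercompacts:
  assumes f: "order_iso M N f" and M: "complete_lattice M" and N: "complete_lattice N"
  shows "f ` supercompacts M = supercompacts N"
proof -
  have "a \<in> f ` supercompacts M" if a: "supercompact N a" for a
  proof (rule image_eqI)
    show "inv_into (carrier M) f a \<in> supercompacts M"
      using order_iso_supercompact[OF order_iso_inv[OF f] N M a] by (simp add: supercompacts_def)
    show "a = f (inv_into (carrier M) f a)"
      using a order_iso_image[OF f] by (simp add: supercompact_def f_inv_into_f)
  qed
  then show ?thesis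
    using order_iso_supercompact[OF f M N] by (auto simp: supercompacts_def)
qed

lemma order_iso_restrict_supercompacts:
  assumes f: "order_iso M N f" and M: "complete_lattice M" and N: "complete_lattice N"
  shows "order_iso (M\<lparr>carrier := supercompacts M\<rparr>) (N\<lparr>carrier := supercompacts N\<rparr>) f"
proof -
  have "bij_betw f (carrier M) (carrier N)"
    using f by (simp add: order_iso_def)
  then have "bij_betw f (supercompacts M) (supercompacts N)"
    by (rule bij_betw_subset[OF _ supercompacts_closed order_iso_supercompacts[OF f M N]])
  moreover have "f x \<sqsubseteq>\<^bsub>N\<^esub> f y \<longleftrightarrow> x \<sqsubseteq>\<^bsub>M\<^esub> y"
    if "x \<in> supercompacts M" "y \<in> supercompacts M" for x y
    by (rule order_iso_le[OF f subsetD[OF supercompacts_closed that(1)]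
          subsetD[OF supercompacts_closed that(2)]])
  ultimately show ?thesis
    by (simp add: order_iso_def)
qed

lemma order_iso_has_supercompact_basis:
  assumes f: "order_iso M N f" and M: "frame M" and N: "frame N"
    and basis: "has_supercompact_basis M"
  shows "has_supercompact_basis N"
proof -
  interpret M: frame M
    by (rule M)
  interpret N: frame N
    by (rule N)
  obtain B where B: "is_basis M B" "B \<subseteq> supercompacts M" "finite_meet_closed M B"
    using basis by (auto simp: has_supercompact_basis_def)
  have BM: "B \<subseteq> carrier M"
    using B(1) by (simp add: is_basis_def)
  have "is_basis N (f ` B)"
    unfolding is_basis_def
  proof (intro conjI ballI)
    show "f ` B \<subseteq> carrier N"
      using BM order_iso_image[OF f] by blast
    fix x assume "x \<in> carrier N"
    then obtain y where y: "y \<in> carrier M" "x = f y"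
      using order_iso_image[OF f] by blast
    then obtain S where S: "S \<subseteq> B" "y = \<Squnion>\<^bsub>M\<^esub>S"
      using B(1) by (auto simp: is_basis_def)
    have "x = \<Squnion>\<^bsub>N\<^esub>(f ` S)"
      using order_iso_sup[OF f M.complete_lattice_axioms N.partial_order_axioms, of S]
        y(2) S BM by simp
    with S show "\<exists>S. S \<subseteq> f ` B \<and> x = \<Squnion>\<^bsub>N\<^esub>S"
      by blast
  qed
  moreover have "f ` B \<subseteq> supercompacts N"
    using B(2) order_iso_supercompacts[OF f M.complete_lattice_axioms N.complete_lattice_axioms]
    by blast
  moreover have "finite_meet_closed N (f ` B)"
    unfolding finite_meet_closed_def
  proof (intro allI impI)
    fix F assume "finite F \<and> F \<subseteq> f ` B"
    then obtain G where G: "G \<subseteq> B" "finite G" "F = f ` G"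
      using finite_subset_image[of F f B] by blast
    have "f (\<Sqinter>\<^bsub>M\<^esub>G) = \<Sqinter>\<^bsub>N\<^esub>F"
      using order_iso_finite_inf[OF f frame_meet_semilattice[OF M] N.partial_order_axioms G(2)] G BM
      by simp
    moreover have "\<Sqinter>\<^bsub>M\<^esub>G \<in> B"
      using B(3) G by (simp add: finite_meet_closed_def)
    ultimately show "\<Sqinter>\<^bsub>N\<^esub>F \<in> f ` B"
      by (metis imageI)
  qed
  ultimately show ?thesis
    unfolding has_supercompact_basis_def by blast
qed

section \<open>The arrows of the two categories\<close>

text \<open>
  The arrows of \<open>SCFrm\<close>, but between frames over different types, as needed for conjugation by a
  relabelling.
\<close>

definition sc_frame_hom :: "'a gorder \<Rightarrow> 'b gorder \<Rightarrow> ('a \<Rightarrow> 'b) set" where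
  "sc_frame_hom L L' = {f \<in> frame_hom L L'. \<forall>a. supercompact L a \<longrightarrow> supercompact L' (f a)}"

lemma mslat_hom_closed: "f \<in> mslat_hom M N \<Longrightarrow> x \<in> carrier M \<Longrightarrow> f x \<in> carrier N"
  by (auto simp: mslat_hom_def)

lemma sc_frame_hom_closed: "f \<in> sc_frame_hom M N \<Longrightarrow> x \<in> carrier M \<Longrightarrow> f x \<in> carrier N"
  by (auto simp: sc_frame_hom_def frame_hom_def)

lemma mslat_hom_inf:
  "f \<in> mslat_hom M N \<Longrightarrow> finite F \<Longrightarrow> F \<subseteq> carrier M \<Longrightarrow> f (\<Sqinter>\<^bsub>M\<^esub>F) = \<Sqinter>\<^bsub>N\<^esub>(f ` F)"
  by (auto simp: mslat_hom_def finite_meet_pres_def)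

lemma sc_frame_hom_sup:
  "f \<in> sc_frame_hom M N \<Longrightarrow> S \<subseteq> carrier M \<Longrightarrow> f (\<Squnion>\<^bsub>M\<^esub>S) = \<Squnion>\<^bsub>N\<^esub>(f ` S)"
  by (auto simp: sc_frame_hom_def frame_hom_def sup_pres_def)

lemma sc_frame_hom_inf:
  "f \<in> sc_frame_hom L L' \<Longrightarrow> finite F \<Longrightarrow> F \<subseteq> carrier L \<Longrightarrow> f (\<Sqinter>\<^bsub>L\<^esub>F) = \<Sqinter>\<^bsub>L'\<^esub>(f ` F)"
  by (auto simp: sc_frame_hom_def frame_hom_def finite_meet_pres_def)

text \<open>
  If \<open>x\<close> lies below \<open>y\<close>, then \<open>x\<close> is the meet of the two, and this meet is preserved.
\<close>

lemma mslat_hom_mono: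
  assumes f: "f \<in> mslat_hom M N" and M: "meet_semilattice M" and N: "meet_semilattice N"
    and xy: "x \<in> carrier M" "y \<in> carrier M" "x \<sqsubseteq>\<^bsub>M\<^esub> y"
  shows "f x \<sqsubseteq>\<^bsub>N\<^esub> f y"
proof -
  interpret M: meet_semilattice M
    by (rule M)
  interpret N: meet_semilattice N
    by (rule N)
  have "\<Sqinter>\<^bsub>M\<^esub>{x, y} = x"
    using xy by (intro M.inf_eqI greatest_LowerI) (auto simp: Lower_def)
  then have "f x = \<Sqinter>\<^bsub>N\<^esub>{f x, f y}"
    using mslat_hom_inf[OF f, of "{x, y}"] xy by simp
  moreover have "\<Sqinter>\<^bsub>N\<^esub>{f x, f y} \<sqsubseteq>\<^bsub>N\<^esub> f y"
    using N.finite_inf_glb[of "{f x, f y}"] xy mslat_hom_closed[OF f]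
    by (intro greatest_Lower_below) auto
  ultimately show ?thesis
    by simp
qed

lemma finite_meet_pres_compose:
  assumes f: "finite_meet_pres M N f" "f \<in> carrier M \<rightarrow> carrier N" and g: "finite_meet_pres N P g"
    and M: "meet_semilattice M"
  shows "finite_meet_pres M P (compose (carrier M) g f)"
  unfolding finite_meet_pres_def
proof (intro allI impI)
  fix F assume F: "finite F \<and> F \<subseteq> carrier M"
  have "\<Sqinter>\<^bsub>M\<^esub>F \<in> carrier M"
    using meet_semilattice.finite_inf_glb[OF M] F by blast
  moreover have "compose (carrier M) g f ` F = g ` f ` F"
    using F by (force simp: compose_def)
  moreover have "finite (f ` F)" "f ` F \<subseteq> carrier N"
    using F f(2) by auto
  ultimately show "compose (carrier M) g f (\<Sqinter>\<^bsub>M\<^esub>F) = \<Sqinter>\<^bsub>P\<^esub>(compose (carrier M) g f ` F)"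
    using F f(1) g by (simp add: compose_def finite_meet_pres_def)
qed

lemma mslat_hom_compose:
  assumes "f \<in> mslat_hom M N" "g \<in> mslat_hom N P" "meet_semilattice M"
  shows "compose (carrier M) g f \<in> mslat_hom M P"
  using assms finite_meet_pres_compose[of M N f P g]
  by (auto simp: mslat_hom_def PiE_iff compose_def)

lemma sc_frame_hom_compose:
  assumes f: "f \<in> sc_frame_hom M N" and g: "g \<in> sc_frame_hom N P" and M: "frame M"
  shows "compose (carrier M) g f \<in> sc_frame_hom M P"
proof -
  interpret M: frame M
    by (rule M)
  have "compose (carrier M) g f (\<Squnion>\<^bsub>M\<^esub>S) = \<Squnion>\<^bsub>P\<^esub>(compose (carrier M) g f ` S)"
    if S: "S \<subseteq> carrier M" for S
  proof -
    have "compose (carrier M) g f ` S = g ` f ` S"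
      using S by (force simp: compose_def)
    moreover have "f ` S \<subseteq> carrier N"
      using S sc_frame_hom_closed[OF f] by blast
    ultimately show ?thesis
      using S by (simp add: compose_def sc_frame_hom_sup[OF f] sc_frame_hom_sup[OF g])
  qed
  moreover have "finite_meet_pres M P (compose (carrier M) g f)"
    using f g frame_meet_semilattice[OF M]
    by (intro finite_meet_pres_compose[of M N]) (auto simp: sc_frame_hom_def frame_hom_def)
  moreover have "supercompact P (compose (carrier M) g f a)" if "supercompact M a" for a
    using f g that by (auto simp: sc_frame_hom_def compose_def supercompact_def)
  ultimately show ?thesis
    using f g sc_frame_hom_closed[OF f] sc_frame_hom_closed[OF g]
    by (auto simp: sc_frame_hom_def frame_hom_def sup_pres_def compose_def)
qed

lemma finite_meet_pres_order_iso:
  assumes f: "order_iso M N f" and M: "meet_semilattice M" and N: "partial_order N"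
  shows "finite_meet_pres M N (restrict f (carrier M))"
  unfolding finite_meet_pres_def
proof (intro allI impI)
  fix F assume F: "finite F \<and> F \<subseteq> carrier M"
  have "\<Sqinter>\<^bsub>M\<^esub>F \<in> carrier M"
    using meet_semilattice.finite_inf_glb[OF M] F by blast
  moreover have "restrict f (carrier M) ` F = f ` F"
    using F by force
  ultimately show "restrict f (carrier M) (\<Sqinter>\<^bsub>M\<^esub>F) = \<Sqinter>\<^bsub>N\<^esub>(restrict f (carrier M) ` F)"
    using order_iso_finite_inf[OF f M N] F by simp
qed

lemma order_iso_mslat_hom:
  assumes f: "order_iso M N f" and M: "meet_semilattice M" and N: "meet_semilattice N"
  shows "restrict f (carrier M) \<in> mslat_hom M N"
proof -
  interpret N: meet_semilattice N
    by (rule N)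
  show ?thesis
    using finite_meet_pres_order_iso[OF f M N.partial_order_axioms] order_iso_closed[OF f]
    by (auto simp: mslat_hom_def)
qed

lemma order_iso_sc_frame_hom:
  assumes f: "order_iso M N f" and M: "frame M" and N: "frame N"
  shows "restrict f (carrier M) \<in> sc_frame_hom M N"
proof -
  interpret M: frame M
    by (rule M)
  interpret N: frame N
    by (rule N)
  have "restrict f (carrier M) ` S = f ` S" if "S \<subseteq> carrier M" for S
    using that by force
  then have "sup_pres M N (restrict f (carrier M))"
    using M.complete_lattice_axioms N.complete_lattice_axioms
      order_iso_sup[OF f M.complete_lattice_axioms N.partial_order_axioms]
    by (simp add: sup_pres_def)
  moreover have "supercompact N (restrict f (carrier M) a)" if "supercompact M a" for a
    using order_iso_supercompact[OF f M.complete_lattice_axioms N.complete_lattice_axioms that] that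
    by (simp add: supercompact_def)
  ultimately show ?thesis
    using finite_meet_pres_order_iso[OF f frame_meet_semilattice[OF M] N.partial_order_axioms]
      order_iso_closed[OF f]
    by (auto simp: sc_frame_hom_def frame_hom_def)
qed

section \<open>Categories of structured sets and contravariant functors between them\<close>

text \<open>
  The properties shared by \<open>mslat_hom\<close> and \<open>sc_frame_hom\<close> that make a category in which order
  isomorphisms are invertible arrows.  The identity of an object is the restriction of the order
  isomorphism \<open>\<lambda>x. x\<close>.
\<close>

locale concrete_cat =
  fixes Ob :: "'a gorder set" and H :: "'a gorder \<Rightarrow> 'a gorder \<Rightarrow> ('a \<Rightarrow> 'a) set"
  assumes hom_extensional: "\<lbrakk>X \<in> Ob; Y \<in> Ob; f \<in> H X Y\<rbrakk> \<Longrightarrow> f \<in> carrier X \<rightarrow>\<^sub>E carrier Y"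
    and hom_compose:
      "\<lbrakk>X \<in> Ob; Y \<in> Ob; Z \<in> Ob; f \<in> H X Y; g \<in> H Y Z\<rbrakk> \<Longrightarrow> compose (carrier X) g f \<in> H X Z"
    and hom_order_iso:
      "\<lbrakk>X \<in> Ob; Y \<in> Ob; order_iso X Y f\<rbrakk> \<Longrightarrow> restrict f (carrier X) \<in> H X Y"
begin

lemma hom_closed: "\<lbrakk>X \<in> Ob; Y \<in> Ob; f \<in> H X Y; x \<in> carrier X\<rbrakk> \<Longrightarrow> f x \<in> carrier Y"
  using hom_extensional by blast

lemma hom_undefined: "\<lbrakk>X \<in> Ob; Y \<in> Ob; f \<in> H X Y; x \<notin> carrier X\<rbrakk> \<Longrightarrow> f x = undefined"
  using hom_extensional by (meson PiE_arb)

lemma hom_eqI: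
  assumes "X \<in> Ob" "Y \<in> Ob" "f \<in> H X Y" "g \<in> H X Y"
    and "\<And>x. x \<in> carrier X \<Longrightarrow> f x = g x"
  shows "f = g"
proof
  show "f x = g x" for x
    using assms hom_undefined[of X Y f x] hom_undefined[of X Y g x] by (cases "x \<in> carrier X") auto
qed

lemma category_concrete: "category (concrete_category Ob H)"
proof (rule category.intro)
  fix X assume "X \<in> Obj (concrete_category Ob H)"
  then show "Ident (concrete_category Ob H) X \<in> Hom (concrete_category Ob H) X X"
    using hom_order_iso[OF _ _ order_iso_refl] by (simp add: concrete_category_def)
next
  fix X Y Z f g
  assume "X \<in> Obj (concrete_category Ob H)" "Y \<in> Obj (concrete_category Ob H)"
    "Z \<in> Obj (concrete_category Ob H)"
    "f \<in> Hom (concrete_category Ob H) X Y" "g \<in> Hom (concrete_category Ob H) Y Z"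
  then show "Comp (concrete_category Ob H) X Y Z g f \<in> Hom (concrete_category Ob H) X Z"
    using hom_compose by (simp add: concrete_category_def)
next
  fix X Y f
  assume XY: "X \<in> Obj (concrete_category Ob H)" "Y \<in> Obj (concrete_category Ob H)"
    "f \<in> Hom (concrete_category Ob H) X Y"
  then have f: "f \<in> carrier X \<rightarrow>\<^sub>E carrier Y"
    using hom_extensional by (simp add: concrete_category_def)
  then show "Comp (concrete_category Ob H) X X Y f (Ident (concrete_category Ob H) X) = f"
    by (auto simp: concrete_category_def compose_def PiE_iff extensional_def fun_eq_iff)
  show "Comp (concrete_category Ob H) X Y Y (Ident (concrete_category Ob H) Y) f = f"
    using f by (auto simp: concrete_category_def compose_def PiE_iff extensional_def fun_eq_iff)
next
  fix W X Y Z f g h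
  assume "W \<in> Obj (concrete_category Ob H)" "X \<in> Obj (concrete_category Ob H)"
    "f \<in> Hom (concrete_category Ob H) W X"
  then have "f \<in> carrier W \<rightarrow> carrier X"
    using hom_closed by (simp add: concrete_category_def Pi_iff)
  then show "Comp (concrete_category Ob H) W X Z (Comp (concrete_category Ob H) X Y Z h g) f =
      Comp (concrete_category Ob H) W Y Z h (Comp (concrete_category Ob H) W X Y g f)"
    by (auto simp: concrete_category_def compose_def Pi_iff fun_eq_iff)
qed

lemma category_opposite_concrete: "category (opposite (concrete_category Ob H))"
proof -
  interpret category "concrete_category Ob H"
    by (rule category_concrete)
  show ?thesis
    by (rule category.intro)
      (auto simp: opposite_def ident_in_hom comp_in_hom ident_left ident_right comp_assoc)
qed

end

text \<open>
  Both categories of the duality are opposites of concrete ones, so every functor that occurs runs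
  between opposites, whereas the mathematics concerns the underlying functions.  This rule and the
  next one turn the equations between arrows into equations between values, with functions written
  in their own direction; the arrow \<open>Y \<rightarrow> X\<close> of the opposite category is the function \<open>f : X \<rightarrow> Y\<close>.
\<close>

lemma contravariant_functorI:
  assumes C: "concrete_cat Ob H" and D: "concrete_cat Ob' H'"
    and obj: "\<And>X. X \<in> Ob \<Longrightarrow> ObjMap F X \<in> Ob'"
    and arr: "\<And>X Y f. \<lbrakk>X \<in> Ob; Y \<in> Ob; f \<in> H X Y\<rbrakk> \<Longrightarrow> ArrMap F Y X f \<in> H' (ObjMap F X) (ObjMap F Y)"
    and ident: "\<And>X x. \<lbrakk>X \<in> Ob; x \<in> carrier (ObjMap F X)\<rbrakk> \<Longrightarrow> ArrMap F X X (\<lambda>x \<in> carrier X. x) x = x"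
    and comp: "\<And>X Y Z f g x. \<lbrakk>X \<in> Ob; Y \<in> Ob; Z \<in> Ob; f \<in> H X Y; g \<in> H Y Z; x \<in> carrier (ObjMap F X)\<rbrakk>
      \<Longrightarrow> ArrMap F Z X (compose (carrier X) g f) x = ArrMap F Z Y g (ArrMap F Y X f x)"
  shows "is_functor (opposite (concrete_category Ob H)) (opposite (concrete_category Ob' H')) F"
proof -
  interpret C: concrete_cat Ob H
    by (rule C)
  interpret D: concrete_cat Ob' H'
    by (rule D)
  have ident_eq: "ArrMap F X X (\<lambda>x \<in> carrier X. x) = (\<lambda>x \<in> carrier (ObjMap F X). x)"
    if X: "X \<in> Ob" for X
  proof (rule D.hom_eqI)
    show "ArrMap F X X (\<lambda>x \<in> carrier X. x) \<in> H' (ObjMap F X) (ObjMap F X)"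
      using arr[OF X X] C.hom_order_iso[OF X X order_iso_refl] by simp
    show "(\<lambda>x \<in> carrier (ObjMap F X). x) \<in> H' (ObjMap F X) (ObjMap F X)"
      using D.hom_order_iso[OF _ _ order_iso_refl] obj[OF X] by simp
  qed (use X obj ident in auto)
  have comp_eq: "ArrMap F Z X (compose (carrier X) g f) =
      compose (carrier (ObjMap F X)) (ArrMap F Z Y g) (ArrMap F Y X f)"
    if "X \<in> Ob" "Y \<in> Ob" "Z \<in> Ob" "f \<in> H X Y" "g \<in> H Y Z" for X Y Z f g
  proof (rule D.hom_eqI)
    show "ArrMap F Z X (compose (carrier X) g f) \<in> H' (ObjMap F X) (ObjMap F Z)"
      using that arr C.hom_compose by blast
    show "compose (carrier (ObjMap F X)) (ArrMap F Z Y g) (ArrMap F Y X f)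
        \<in> H' (ObjMap F X) (ObjMap F Z)"
      using that arr obj by (intro D.hom_compose[where Y = "ObjMap F Y"]) auto
  qed (use that obj comp in \<open>auto simp: compose_def\<close>)
  show ?thesis
    using C.category_opposite_concrete D.category_opposite_concrete obj arr ident_eq comp_eq
    by (auto intro!: is_functor.intro is_functor_axioms.intro
        simp: opposite_def concrete_category_def)
qed

text \<open>
  The map \<open>\<theta> X\<close> goes from \<open>F X\<close> to \<open>G X\<close> as a function, so in the opposite category it is an arrow
  from \<open>G X\<close> to \<open>F X\<close>; the component of the natural isomorphism from \<open>F\<close> to \<open>G\<close> is its inverse.
\<close>

lemma naturally_isomorphicI:
  assumes C: "concrete_cat Ob H" and D: "concrete_cat Ob' H'"
    and F: "is_functor (opposite (concrete_category Ob H)) (opposite (concrete_category Ob' H')) F"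
    and G: "is_functor (opposite (concrete_category Ob H)) (opposite (concrete_category Ob' H')) G"
    and iso: "\<And>X. X \<in> Ob \<Longrightarrow> order_iso (ObjMap F X) (ObjMap G X) (\<theta> X)"
    and natural: "\<And>X Y f x. \<lbrakk>X \<in> Ob; Y \<in> Ob; f \<in> H X Y; x \<in> carrier (ObjMap F X)\<rbrakk>
      \<Longrightarrow> \<theta> Y (ArrMap F Y X f x) = ArrMap G Y X f (\<theta> X x)"
  shows "naturally_isomorphic
    (opposite (concrete_category Ob H)) (opposite (concrete_category Ob' H')) F G"
proof -
  interpret C: concrete_cat Ob H
    by (rule C)
  interpret D: concrete_cat Ob' H'
    by (rule D)
  have objF: "ObjMap F X \<in> Ob'" and objG: "ObjMap G X \<in> Ob'" if "X \<in> Ob" for X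
    using is_functor.obj_map[OF F, of X] is_functor.obj_map[OF G, of X] that
    by (auto simp: opposite_def concrete_category_def)
  have arrF: "ArrMap F Y X f \<in> H' (ObjMap F X) (ObjMap F Y)"
    and arrG: "ArrMap G Y X f \<in> H' (ObjMap G X) (ObjMap G Y)"
    if "X \<in> Ob" "Y \<in> Ob" "f \<in> H X Y" for X Y f
    using is_functor.arr_map[OF F, of Y X f] is_functor.arr_map[OF G, of Y X f] that
    by (auto simp: opposite_def concrete_category_def)
  define \<eta> where "\<eta> X = restrict (inv_into (carrier (ObjMap F X)) (\<theta> X)) (carrier (ObjMap G X))" for X
  have \<eta>: "\<eta> X \<in> H' (ObjMap G X) (ObjMap F X)" if "X \<in> Ob" for X
    unfolding \<eta>_def
    using that objF objG by (intro D.hom_order_iso order_iso_inv iso) auto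
  have \<theta>: "restrict (\<theta> X) (carrier (ObjMap F X)) \<in> H' (ObjMap F X) (ObjMap G X)" if "X \<in> Ob" for X
    using that objF objG by (intro D.hom_order_iso iso) auto
  have \<theta>_closed: "\<theta> X x \<in> carrier (ObjMap G X)" if "X \<in> Ob" "x \<in> carrier (ObjMap F X)" for X x
    using that by (rule order_iso_closed[OF iso])
  have \<eta>_closed: "\<eta> X y \<in> carrier (ObjMap F X)" if "X \<in> Ob" "y \<in> carrier (ObjMap G X)" for X y
    using D.hom_closed[OF objG objF \<eta>] that by simp
  have \<theta>\<eta>: "\<theta> X (\<eta> X y) = y" if "X \<in> Ob" "y \<in> carrier (ObjMap G X)" for X y
    using that order_iso_image[OF iso] by (simp add: \<eta>_def f_inv_into_f)
  have \<eta>\<theta>: "\<eta> X (\<theta> X x) = x" if "X \<in> Ob" "x \<in> carrier (ObjMap F X)" for X x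
    using that iso[OF that(1)] \<theta>_closed[OF that]
    by (simp add: \<eta>_def order_iso_def bij_betw_def inv_into_f_f)
  have "iso_in (opposite (concrete_category Ob' H')) (ObjMap F X) (ObjMap G X) (\<eta> X)"
    if X: "X \<in> Ob" for X
    unfolding iso_in_def
  proof (intro conjI bexI)
    show "\<eta> X \<in> Hom (opposite (concrete_category Ob' H')) (ObjMap F X) (ObjMap G X)"
      using \<eta>[OF X] by (simp add: opposite_def concrete_category_def)
    show "restrict (\<theta> X) (carrier (ObjMap F X))
        \<in> Hom (opposite (concrete_category Ob' H')) (ObjMap G X) (ObjMap F X)"
      using \<theta>[OF X] by (simp add: opposite_def concrete_category_def)
  qed (use X \<eta>_closed \<theta>_closed in
      \<open>auto simp: opposite_def concrete_category_def compose_def fun_eq_iff \<theta>\<eta> \<eta>\<theta>\<close>)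
  moreover have "compose (carrier (ObjMap G X)) (\<eta> Y) (ArrMap G Y X f) =
      compose (carrier (ObjMap G X)) (ArrMap F Y X f) (\<eta> X)"
    if "X \<in> Ob" "Y \<in> Ob" "f \<in> H X Y" for X Y f
  proof (rule D.hom_eqI)
    show "compose (carrier (ObjMap G X)) (\<eta> Y) (ArrMap G Y X f) \<in> H' (ObjMap G X) (ObjMap F Y)"
      using that objF objG \<eta> arrG by (intro D.hom_compose[where Y = "ObjMap G Y"]) auto
    show "compose (carrier (ObjMap G X)) (ArrMap F Y X f) (\<eta> X) \<in> H' (ObjMap G X) (ObjMap F Y)"
      using that objF objG \<eta> arrF by (intro D.hom_compose[where Y = "ObjMap F X"]) auto
    fix y assume y: "y \<in> carrier (ObjMap G X)"
    have "\<eta> Y (ArrMap G Y X f y) = \<eta> Y (ArrMap G Y X f (\<theta> X (\<eta> X y)))"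
      using that y by (simp add: \<theta>\<eta>)
    also have "\<dots> = \<eta> Y (\<theta> Y (ArrMap F Y X f (\<eta> X y)))"
      using that y by (simp add: natural \<eta>_closed)
    also have "\<dots> = ArrMap F Y X f (\<eta> X y)"
      using that y D.hom_closed[OF objF objF arrF] by (simp add: \<eta>\<theta> \<eta>_closed)
    finally show "compose (carrier (ObjMap G X)) (\<eta> Y) (ArrMap G Y X f) y =
        compose (carrier (ObjMap G X)) (ArrMap F Y X f) (\<eta> X) y"
      using y by (simp add: compose_def)
  qed (use that objF objG in auto)
  ultimately show ?thesis
    using F G unfolding naturally_isomorphic_def natural_iso_def
    by (intro exI[of _ \<eta>]) (auto simp: opposite_def concrete_category_def)
qed

lemma is_functor_id: "category C \<Longrightarrow> is_functor C C id_functor"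
  by (intro is_functor.intro is_functor_axioms.intro) (simp_all add: id_functor_def)

lemma is_functor_comp:
  assumes F: "is_functor C D F" and G: "is_functor D E G"
  shows "is_functor C E (G \<circ>\<^sub>F F)"
proof -
  interpret F: is_functor C D F
    by (rule F)
  interpret G: is_functor D E G
    by (rule G)
  show ?thesis
    by unfold_locales
      (simp_all add: comp_functor_def F.obj_map F.arr_map F.map_ident F.map_comp
        G.obj_map G.arr_map G.map_ident G.map_comp)
qed

definition MSLat_obj :: "'a set set \<Rightarrow> 'a gorder set" where
  "MSLat_obj K = {M. meet_semilattice M \<and> carrier M \<in> K}"

definition SCFrm_obj :: "'a set set \<Rightarrow> 'a gorder set" where
  "SCFrm_obj K = {L. frame L \<and> has_supercompact_basis L \<and> carrier L \<in> K}"

lemma MSLat_eq: "MSLat K = concrete_category (MSLat_obj K) mslat_hom"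
  by (simp add: MSLat_def MSLat_obj_def)

lemma SCLoc_eq: "SCLoc K = opposite (concrete_category (SCFrm_obj K) sc_frame_hom)"
  by (simp add: SCLoc_def SCFrm_def SCFrm_obj_def sc_frame_hom_def[abs_def])

lemma concrete_cat_MSLat: "concrete_cat (MSLat_obj K) mslat_hom"
proof
  show "f \<in> carrier X \<rightarrow>\<^sub>E carrier Y" if "f \<in> mslat_hom X Y" for X Y :: "'a gorder" and f
    using that by (simp add: mslat_hom_def)
qed (auto simp: MSLat_obj_def intro: mslat_hom_compose order_iso_mslat_hom)

lemma concrete_cat_SCFrm: "concrete_cat (SCFrm_obj K) sc_frame_hom"
proof
  show "f \<in> carrier X \<rightarrow>\<^sub>E carrier Y" if "f \<in> sc_frame_hom X Y" for X Y :: "'a gorder" and f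
    using that by (simp add: sc_frame_hom_def frame_hom_def)
qed (auto simp: SCFrm_obj_def intro: sc_frame_hom_compose order_iso_sc_frame_hom)

section \<open>Change of carrier\<close>

lemma carrier_relabel: "carrier (relabel e L) = e ` carrier L"
  by (simp add: relabel_def)

lemma order_iso_relabel: "inj_on e (carrier L) \<Longrightarrow> order_iso L (relabel e L) e"
  by (simp add: order_iso_def relabel_def bij_betw_def the_inv_into_f_f)

lemma relabel_map_eq:
  "relabel_map e L L' f (e x) = e (f x)" if "inj_on e (carrier L)" "x \<in> carrier L"
  using that by (simp add: relabel_map_def the_inv_into_f_f)

text \<open>
  Being a conjugate by order isomorphisms, \<open>relabel_map\<close> preserves whatever class of arrows contains
  the order isomorphisms and is closed under composition.
\<close>

lemma relabel_map_conjugate: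
  assumes e: "inj_on e (carrier L)" and f: "f \<in> carrier L \<rightarrow> carrier L'"
  shows "relabel_map e L L' f =
    compose (carrier (relabel e L)) (compose (carrier L) (restrict e (carrier L')) f)
      (restrict (inv_into (carrier L) e) (carrier (relabel e L)))"
proof
  fix y
  show "relabel_map e L L' f y =
    compose (carrier (relabel e L)) (compose (carrier L) (restrict e (carrier L')) f)
      (restrict (inv_into (carrier L) e) (carrier (relabel e L))) y"
  proof (cases "y \<in> e ` carrier L")
    case True
    then obtain x where "x \<in> carrier L" "y = e x"
      by blast
    with e f show ?thesis
      by (auto simp: relabel_map_eq compose_def carrier_relabel inv_into_f_f Pi_iff)
  next
    case False
    then show ?thesis
      by (simp add: relabel_map_def compose_def carrier_relabel)
  qed
qed

lemma relabel_meet_semilattice: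
  "inj_on e (carrier M) \<Longrightarrow> meet_semilattice M \<Longrightarrow> meet_semilattice (relabel e M)"
  by (rule order_iso_meet_semilattice[OF order_iso_relabel]) (simp_all add: relabel_def)

lemma relabel_frame: "inj_on e (carrier L) \<Longrightarrow> frame L \<Longrightarrow> frame (relabel e L)"
  by (rule order_iso_frame[OF order_iso_relabel]) (simp_all add: relabel_def)

lemma relabel_has_supercompact_basis:
  "inj_on e (carrier L) \<Longrightarrow> frame L \<Longrightarrow> has_supercompact_basis L \<Longrightarrow>
    has_supercompact_basis (relabel e L)"
  by (rule order_iso_has_supercompact_basis[OF order_iso_relabel _ relabel_frame])

lemma relabel_mslat_hom:
  assumes e: "inj_on e (carrier M)" "inj_on e (carrier N)"
    and M: "meet_semilattice M" and N: "meet_semilattice N" and f: "f \<in> mslat_hom M N"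
  shows "relabel_map e M N f \<in> mslat_hom (relabel e M) (relabel e N)"
proof -
  have f_fun: "f \<in> carrier M \<rightarrow> carrier N"
    using f by (auto simp: mslat_hom_def)
  show ?thesis
    unfolding relabel_map_conjugate[OF e(1) f_fun]
    by (intro mslat_hom_compose[where N = M] mslat_hom_compose[where N = N] f M
        order_iso_mslat_hom order_iso_inv order_iso_relabel e relabel_meet_semilattice N)
qed

lemma relabel_sc_frame_hom:
  assumes e: "inj_on e (carrier L)" "inj_on e (carrier L')"
    and L: "frame L" and L': "frame L'" and f: "f \<in> sc_frame_hom L L'"
  shows "relabel_map e L L' f \<in> sc_frame_hom (relabel e L) (relabel e L')"
proof -
  have f_fun: "f \<in> carrier L \<rightarrow> carrier L'"
    using f by (auto simp: sc_frame_hom_def frame_hom_def)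
  show ?thesis
    unfolding relabel_map_conjugate[OF e(1) f_fun]
    by (intro sc_frame_hom_compose[where N = L] sc_frame_hom_compose[where N = L'] f L
        order_iso_sc_frame_hom order_iso_inv order_iso_relabel e relabel_frame L')
qed

lemma is_functor_relabel:
  assumes C: "concrete_cat Ob H" and D: "concrete_cat Ob' H'"
    and e: "\<And>X. X \<in> Ob \<Longrightarrow> inj_on e (carrier X)"
    and obj: "\<And>X. X \<in> Ob \<Longrightarrow> relabel e X \<in> Ob'"
    and arr: "\<And>X Y f. \<lbrakk>X \<in> Ob; Y \<in> Ob; f \<in> H X Y\<rbrakk>
      \<Longrightarrow> relabel_map e X Y f \<in> H' (relabel e X) (relabel e Y)"
  shows "is_functor (opposite (concrete_category Ob H)) (opposite (concrete_category Ob' H'))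
    (relabel_functor e)"
proof (rule contravariant_functorI[OF C D])
  interpret C: concrete_cat Ob H
    by (rule C)
  show "ArrMap (relabel_functor e) X X (\<lambda>x\<in>carrier X. x) x = x"
    if "X \<in> Ob" "x \<in> carrier (ObjMap (relabel_functor e) X)" for X x
    using that by (auto simp: relabel_functor_def carrier_relabel relabel_map_eq e)
  show "ArrMap (relabel_functor e) Z X (compose (carrier X) g f) x =
      ArrMap (relabel_functor e) Z Y g (ArrMap (relabel_functor e) Y X f x)"
    if X: "X \<in> Ob" and Y: "Y \<in> Ob" and Z: "Z \<in> Ob" and f: "f \<in> H X Y" and g: "g \<in> H Y Z"
      and x: "x \<in> carrier (ObjMap (relabel_functor e) X)" for X Y Z f g x
  proof -
    obtain x' where x': "x' \<in> carrier X" "x = e x'"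
      using x by (auto simp: relabel_functor_def carrier_relabel)
    with C.hom_closed[OF X Y f] show ?thesis
      by (simp add: relabel_functor_def relabel_map_eq e X Y compose_def)
  qed
qed (simp_all add: relabel_functor_def obj arr)

lemma is_functor_relabel_MSLat:
  assumes "\<And>X. X \<in> K \<Longrightarrow> inj_on e X" "\<And>X. X \<in> K \<Longrightarrow> e ` X \<in> K'"
  shows "is_functor (opposite (MSLat K)) (opposite (MSLat K')) (relabel_functor e)"
  unfolding MSLat_eq
  by (rule is_functor_relabel[OF concrete_cat_MSLat concrete_cat_MSLat])
    (auto simp: MSLat_obj_def assms carrier_relabel
      intro: relabel_meet_semilattice relabel_mslat_hom)

lemma is_functor_relabel_SCLoc:
  assumes "\<And>X. X \<in> K \<Longrightarrow> inj_on e X" "\<And>X. X \<in> K \<Longrightarrow> e ` X \<in> K'"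
  shows "is_functor (SCLoc K) (SCLoc K') (relabel_functor e)"
  unfolding SCLoc_eq
  by (rule is_functor_relabel[OF concrete_cat_SCFrm concrete_cat_SCFrm])
    (auto simp: SCFrm_obj_def assms carrier_relabel
      intro: relabel_frame relabel_has_supercompact_basis relabel_sc_frame_hom)

section \<open>The frame of lower sets\<close>

lemma carrier_Id_frame: "carrier (Id_frame M) = lower_sets M"
  by (simp add: Id_frame_def)

lemma le_Id_frame: "S \<sqsubseteq>\<^bsub>Id_frame M\<^esub> T \<longleftrightarrow> S \<subseteq> T"
  by (simp add: Id_frame_def)

lemma partial_order_Id_frame: "partial_order (Id_frame M)"
  by unfold_locales (auto simp: Id_frame_def)

lemma lower_sets_Union: "\<S> \<subseteq> lower_sets M \<Longrightarrow> \<Union>\<S> \<in> lower_sets M"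
  unfolding lower_sets_def by blast

lemma lower_sets_Inter: "\<S> \<subseteq> lower_sets M \<Longrightarrow> carrier M \<inter> \<Inter>\<S> \<in> lower_sets M"
  unfolding lower_sets_def by blast

lemma is_lub_Id_frame: "\<S> \<subseteq> lower_sets M \<Longrightarrow> is_lub (Id_frame M) (\<Union>\<S>) \<S>"
  using lower_sets_Union
  by (intro least_UpperI) (auto simp: carrier_Id_frame le_Id_frame Upper_def)

lemma is_glb_Id_frame:
  assumes "\<S> \<subseteq> lower_sets M"
  shows "is_glb (Id_frame M) (carrier M \<inter> \<Inter>\<S>) \<S>"
proof (rule greatest_LowerI)
  fix T assume "T \<in> Lower (Id_frame M) \<S>"
  then have "T \<in> lower_sets M" "\<And>S. S \<in> \<S> \<Longrightarrow> T \<subseteq> S"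
    using assms by (auto simp: Lower_def carrier_Id_frame le_Id_frame)
  then show "T \<sqsubseteq>\<^bsub>Id_frame M\<^esub> carrier M \<inter> \<Inter>\<S>"
    by (auto simp: le_Id_frame lower_sets_def)
qed (use assms lower_sets_Inter in \<open>auto simp: carrier_Id_frame le_Id_frame\<close>)

lemma sup_Id_frame: "\<S> \<subseteq> lower_sets M \<Longrightarrow> \<Squnion>\<^bsub>Id_frame M\<^esub>\<S> = \<Union>\<S>"
  by (rule partial_order.sup_eqI[OF partial_order_Id_frame is_lub_Id_frame])

text \<open>The factor \<open>carrier M\<close> is the value of the empty meet.\<close>

lemma inf_Id_frame: "\<S> \<subseteq> lower_sets M \<Longrightarrow> \<Sqinter>\<^bsub>Id_frame M\<^esub>\<S> = carrier M \<inter> \<Inter>\<S>"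
  by (rule partial_order.inf_eqI[OF partial_order_Id_frame is_glb_Id_frame])

lemma frame_Id_frame: "frame (Id_frame M)"
proof -
  interpret partial_order "Id_frame M"
    by (rule partial_order_Id_frame)
  show ?thesis
  proof
    fix \<S> assume \<S>: "\<S> \<subseteq> carrier (Id_frame M)"
    show "\<exists>S. is_lub (Id_frame M) S \<S>"
      using \<S> is_lub_Id_frame by (metis carrier_Id_frame)
    show "\<exists>S. is_glb (Id_frame M) S \<S>"
      using \<S> is_glb_Id_frame by (metis carrier_Id_frame)
    fix S assume S: "S \<in> carrier (Id_frame M)"
    have meet: "S \<sqinter>\<^bsub>Id_frame M\<^esub> T = S \<inter> T" if "T \<in> lower_sets M" for T
      using S that by (auto simp: meet_def inf_Id_frame carrier_Id_frame lower_sets_def)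
    have "(\<lambda>T. S \<inter> T) ` \<S> \<subseteq> lower_sets M"
      using S \<S> by (auto simp: carrier_Id_frame lower_sets_def)
    moreover have "(\<lambda>T. S \<sqinter>\<^bsub>Id_frame M\<^esub> T) ` \<S> = (\<lambda>T. S \<inter> T) ` \<S>"
      using \<S> meet by (auto simp: carrier_Id_frame subset_iff intro!: image_cong)
    ultimately show "S \<sqinter>\<^bsub>Id_frame M\<^esub> \<Squnion>\<^bsub>Id_frame M\<^esub>\<S> =
        \<Squnion>\<^bsub>Id_frame M\<^esub>((\<lambda>T. S \<sqinter>\<^bsub>Id_frame M\<^esub> T) ` \<S>)"
      using \<S> by (simp add: carrier_Id_frame sup_Id_frame meet lower_sets_Union)
  qed
qed

text \<open>
  \<open>partial_order\<close> allows further record fields, which \<open>Id_frame\<close> does not.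
\<close>

locale poset = partial_order L for L :: "'a gorder" (structure)

sublocale meet_semilattice \<subseteq> poset ..

definition principal_ideal :: "'a gorder \<Rightarrow> 'a \<Rightarrow> 'a set" where
  "principal_ideal M x = {y \<in> carrier M. y \<sqsubseteq>\<^bsub>M\<^esub> x}"

lemma (in poset) principal_ideal_lower_set: "x \<in> carrier L \<Longrightarrow> principal_ideal L x \<in> lower_sets L"
  by (auto simp: principal_ideal_def lower_sets_def dest: le_trans)

lemma (in poset) principal_ideal_subset_iff:
  "x \<in> carrier L \<Longrightarrow> S \<in> lower_sets L \<Longrightarrow> principal_ideal L x \<subseteq> S \<longleftrightarrow> x \<in> S"
  by (auto simp: principal_ideal_def lower_sets_def)

text \<open>
  A lower set is the union of the principal ideals of its elements, so a supercompact one is among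
  them.  Conversely, if the principal ideal of \<open>x\<close> is a union of lower sets, one of them contains \<open>x\<close>, hence
  the whole ideal.
\<close>

lemma (in poset) supercompact_Id_frame_iff:
  "supercompact (Id_frame L) S \<longleftrightarrow> S \<in> principal_ideal L ` carrier L"
proof
  assume S: "supercompact (Id_frame L) S"
  then have low: "S \<in> lower_sets L"
    by (simp add: supercompact_def carrier_Id_frame)
  then have SL: "S \<subseteq> carrier L"
    by (simp add: lower_sets_def)
  then have sub: "principal_ideal L ` S \<subseteq> lower_sets L"
    using principal_ideal_lower_set by blast
  have "x \<in> principal_ideal L x" if "x \<in> S" for x
    using that SL by (auto simp: principal_ideal_def)
  then have "S = \<Union>(principal_ideal L ` S)"
    using SL low principal_ideal_subset_iff by blast
  then have "S = \<Squnion>\<^bsub>Id_frame L\<^esub>(principal_ideal L ` S)"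
    using sub by (simp add: sup_Id_frame)
  with S sub have "S \<in> principal_ideal L ` S"
    unfolding supercompact_def carrier_Id_frame by blast
  with SL show "S \<in> principal_ideal L ` carrier L"
    by blast
next
  assume "S \<in> principal_ideal L ` carrier L"
  then obtain x where x: "x \<in> carrier L" "S = principal_ideal L x"
    by blast
  have "principal_ideal L x \<in> \<S>" if \<S>: "\<S> \<subseteq> lower_sets L" "principal_ideal L x = \<Union>\<S>" for \<S>
  proof -
    have "x \<in> \<Union>\<S>"
      using \<S>(2) x(1) by (auto simp: principal_ideal_def)
    then obtain T where T: "T \<in> \<S>" "x \<in> T"
      by blast
    then have "principal_ideal L x \<subseteq> T"
      using \<S>(1) x(1) principal_ideal_subset_iff by blast
    with T \<S> have "T = principal_ideal L x"
      by blast
    with T show ?thesis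
      by simp
  qed
  with x show "supercompact (Id_frame L) S"
    by (auto simp: supercompact_def carrier_Id_frame principal_ideal_lower_set sup_Id_frame)
qed

lemma (in poset) supercompacts_Id_frame:
  "supercompacts (Id_frame L) = principal_ideal L ` carrier L"
  by (auto simp: supercompacts_def supercompact_Id_frame_iff)

lemma (in meet_semilattice) has_supercompact_basis_Id_frame: "has_supercompact_basis (Id_frame L)"
proof -
  have "is_basis (Id_frame L) (principal_ideal L ` carrier L)"
    unfolding is_basis_def carrier_Id_frame
  proof (intro conjI ballI)
    show "principal_ideal L ` carrier L \<subseteq> lower_sets L"
      using principal_ideal_lower_set by blast
    fix S assume S: "S \<in> lower_sets L"
    then have SL: "S \<subseteq> carrier L"
      by (simp add: lower_sets_def)
    have "x \<in> principal_ideal L x" if "x \<in> S" for x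
      using that SL by (auto simp: principal_ideal_def)
    then have "S = \<Union>(principal_ideal L ` S)"
      using SL S principal_ideal_subset_iff by blast
    moreover have "principal_ideal L ` S \<subseteq> lower_sets L"
      using SL principal_ideal_lower_set by blast
    ultimately show "\<exists>\<S>. \<S> \<subseteq> principal_ideal L ` carrier L \<and> S = \<Squnion>\<^bsub>Id_frame L\<^esub>\<S>"
      using SL by (intro exI[of _ "principal_ideal L ` S"]) (auto simp: sup_Id_frame)
  qed
  moreover have "finite_meet_closed (Id_frame L) (principal_ideal L ` carrier L)"
    unfolding finite_meet_closed_def
  proof (intro allI impI)
    fix \<F> assume "finite \<F> \<and> \<F> \<subseteq> principal_ideal L ` carrier L"
    then obtain F where F: "F \<subseteq> carrier L" "finite F" "\<F> = principal_ideal L ` F"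
      using finite_subset_image[of \<F> "principal_ideal L" "carrier L"] by blast
    note glb = finite_inf_glb[OF F(2,1)]
    have "\<Sqinter>\<^bsub>Id_frame L\<^esub>\<F> = carrier L \<inter> \<Inter>(principal_ideal L ` F)"
      using F principal_ideal_lower_set by (auto intro!: inf_Id_frame)
    also have "\<dots> = Lower L F"
      using F by (auto simp: Lower_def principal_ideal_def)
    also have "\<dots> = principal_ideal L (\<Sqinter>F)"
    proof
      show "Lower L F \<subseteq> principal_ideal L (\<Sqinter>F)"
        using glb Lower_closed[of L F] unfolding greatest_def principal_ideal_def by blast
      show "principal_ideal L (\<Sqinter>F) \<subseteq> Lower L F"
      proof
        fix y assume y: "y \<in> principal_ideal L (\<Sqinter>F)"
        show "y \<in> Lower L F"
        proof (rule Lower_memI)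
          fix x assume "x \<in> F"
          then show "y \<sqsubseteq> x"
            using y F glb greatest_Lower_below[OF glb _ F(1)] le_trans[of y "\<Sqinter>F" x]
            by (auto simp: principal_ideal_def)
        qed (use y in \<open>simp add: principal_ideal_def\<close>)
      qed
    qed
    finally show "\<Sqinter>\<^bsub>Id_frame L\<^esub>\<F> \<in> principal_ideal L ` carrier L"
      using glb by blast
  qed
  ultimately show ?thesis
    unfolding has_supercompact_basis_def supercompacts_Id_frame by blast
qed

lemma (in poset) order_iso_principal_ideal:
  "order_iso L ((Id_frame L)\<lparr>carrier := supercompacts (Id_frame L)\<rparr>) (principal_ideal L)"
proof -
  have le: "principal_ideal L x \<subseteq> principal_ideal L y \<longleftrightarrow> x \<sqsubseteq> y" if "x \<in> carrier L" "y \<in> carrier L" for x y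
    using that principal_ideal_subset_iff[OF _ principal_ideal_lower_set] by (auto simp: principal_ideal_def)
  then have "inj_on (principal_ideal L) (carrier L)"
    by (metis inj_onI le_antisym order_refl)
  with le show ?thesis
    by (simp add: order_iso_def bij_betw_def supercompacts_Id_frame le_Id_frame)
qed

section \<open>The functor of lower sets\<close>

lemma lower_closure_lower_set:
  "partial_order N \<Longrightarrow> T \<subseteq> carrier N \<Longrightarrow> lower_closure N T \<in> lower_sets N"
proof -
  assume "partial_order N" and T: "T \<subseteq> carrier N"
  then interpret partial_order N
    by simp
  show ?thesis
    using T le_trans unfolding lower_closure_def lower_sets_def by blast
qed

lemma lower_closure_Union: "lower_closure N (\<Union>\<T>) = \<Union>(lower_closure N ` \<T>)"
  by (auto simp: lower_closure_def)

lemma lower_closure_mono: "S \<subseteq> T \<Longrightarrow> lower_closure N S \<subseteq> lower_closure N T"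
  by (auto simp: lower_closure_def)

lemma lower_closure_id: "partial_order N \<Longrightarrow> S \<in> lower_sets N \<Longrightarrow> lower_closure N S = S"
proof -
  assume "partial_order N" and S: "S \<in> lower_sets N"
  then interpret partial_order N
    by simp
  show ?thesis
    using S le_refl unfolding lower_closure_def lower_sets_def by blast
qed

context
  fixes M :: "'a gorder" and N :: "'b gorder" and f :: "'a \<Rightarrow> 'b"
  assumes M: "meet_semilattice M" and N: "meet_semilattice N" and f: "f \<in> mslat_hom M N"
begin

interpretation M: meet_semilattice M
  by (rule M)

interpretation N: meet_semilattice N
  by (rule N)

lemma lower_closure_image_lower_set: "S \<in> lower_sets M \<Longrightarrow> lower_closure N (f ` S) \<in> lower_sets N"
  using mslat_hom_closed[OF f]
  by (intro lower_closure_lower_set N.partial_order_axioms) (auto simp: lower_sets_def)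

text \<open>
  Naturality of \<open>x \<mapsto> \<down>x\<close>; it also shows that \<open>S \<mapsto> \<down>(f ` S)\<close> sends supercompact elements to
  supercompact elements.
\<close>

lemma lower_closure_image_principal_ideal:
  assumes x: "x \<in> carrier M"
  shows "lower_closure N (f ` principal_ideal M x) = principal_ideal N (f x)"
proof
  have fx: "f x \<in> carrier N"
    by (rule mslat_hom_closed[OF f x])
  have "f y \<in> carrier N \<and> f y \<sqsubseteq>\<^bsub>N\<^esub> f x" if "y \<in> principal_ideal M x" for y
    using that x mslat_hom_mono[OF f M N] mslat_hom_closed[OF f] by (auto simp: principal_ideal_def)
  with fx show "lower_closure N (f ` principal_ideal M x) \<subseteq> principal_ideal N (f x)"
    using N.le_trans unfolding lower_closure_def principal_ideal_def by blast
  show "principal_ideal N (f x) \<subseteq> lower_closure N (f ` principal_ideal M x)"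
    using x by (auto simp: lower_closure_def principal_ideal_def)
qed

text \<open>
  If \<open>y\<close> lies below \<open>f (x S)\<close> with \<open>x S \<in> S\<close> for each \<open>S \<in> \<F>\<close>, then it lies below the meet of these
  finitely many values, which is \<open>f\<close> applied to the meet of the \<open>x S\<close>; and the latter meet belongs to
  every \<open>S \<in> \<F>\<close>.  For \<open>\<F> = {}\<close> this says that \<open>f\<close> preserves the top element.
\<close>

lemma lower_closure_image_Inter:
  assumes fin: "finite \<F>" and \<F>: "\<F> \<subseteq> lower_sets M"
  shows "lower_closure N (f ` (carrier M \<inter> \<Inter>\<F>)) =
    carrier N \<inter> \<Inter>((\<lambda>S. lower_closure N (f ` S)) ` \<F>)"
proof
  show "lower_closure N (f ` (carrier M \<inter> \<Inter>\<F>)) \<subseteq>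
      carrier N \<inter> \<Inter>((\<lambda>S. lower_closure N (f ` S)) ` \<F>)"
    by (auto simp: lower_closure_def)
  show "carrier N \<inter> \<Inter>((\<lambda>S. lower_closure N (f ` S)) ` \<F>) \<subseteq>
      lower_closure N (f ` (carrier M \<inter> \<Inter>\<F>))"
  proof
    fix y assume y: "y \<in> carrier N \<inter> \<Inter>((\<lambda>S. lower_closure N (f ` S)) ` \<F>)"
    then have "\<forall>S \<in> \<F>. \<exists>x \<in> S. y \<sqsubseteq>\<^bsub>N\<^esub> f x"
      by (auto simp: lower_closure_def)
    then obtain x where x: "\<And>S. S \<in> \<F> \<Longrightarrow> x S \<in> S \<and> y \<sqsubseteq>\<^bsub>N\<^esub> f (x S)"
      by metis
    have X: "finite (x ` \<F>)" "x ` \<F> \<subseteq> carrier M"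
      using fin \<F> x by (auto simp: lower_sets_def subset_iff)
    note glb = M.finite_inf_glb[OF X]
    have inf_in: "\<Sqinter>\<^bsub>M\<^esub>(x ` \<F>) \<in> S" if S: "S \<in> \<F>" for S
      using greatest_Lower_below[OF glb imageI[OF S] X(2)] x[OF S] S \<F> greatest_closed[OF glb]
      by (auto simp: lower_sets_def subset_iff)
    have fX: "finite (f ` x ` \<F>)" "f ` x ` \<F> \<subseteq> carrier N"
      using X mslat_hom_closed[OF f] by auto
    have "y \<in> Lower N (f ` x ` \<F>)"
      using x y by (auto intro: Lower_memI)
    then have "y \<sqsubseteq>\<^bsub>N\<^esub> \<Sqinter>\<^bsub>N\<^esub>(f ` x ` \<F>)"
      by (rule greatest_le[OF N.finite_inf_glb[OF fX]])
    then have "y \<sqsubseteq>\<^bsub>N\<^esub> f (\<Sqinter>\<^bsub>M\<^esub>(x ` \<F>))"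
      by (simp add: mslat_hom_inf[OF f X])
    with y inf_in greatest_closed[OF glb] show "y \<in> lower_closure N (f ` (carrier M \<inter> \<Inter>\<F>))"
      unfolding lower_closure_def by blast
  qed
qed

lemma A_map_sc_frame_hom:
  "(\<lambda>S \<in> lower_sets M. lower_closure N (f ` S)) \<in> sc_frame_hom (Id_frame M) (Id_frame N)"
proof -
  let ?h = "\<lambda>S \<in> lower_sets M. lower_closure N (f ` S)"
  interpret Id_M: frame "Id_frame M"
    by (rule frame_Id_frame)
  interpret Id_N: frame "Id_frame N"
    by (rule frame_Id_frame)
  have img: "?h ` \<S> = (\<lambda>S. lower_closure N (f ` S)) ` \<S>" if "\<S> \<subseteq> lower_sets M" for \<S>
    using that by (intro image_cong) auto
  have img_low: "(\<lambda>S. lower_closure N (f ` S)) ` \<S> \<subseteq> lower_sets N" if "\<S> \<subseteq> lower_sets M" for \<S>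
    using that lower_closure_image_lower_set by blast
  have "?h \<in> carrier (Id_frame M) \<rightarrow>\<^sub>E carrier (Id_frame N)"
    by (auto simp: carrier_Id_frame lower_closure_image_lower_set)
  moreover have "finite_meet_pres (Id_frame M) (Id_frame N) ?h"
    unfolding finite_meet_pres_def carrier_Id_frame
  proof (intro allI impI)
    fix \<F> assume \<F>: "finite \<F> \<and> \<F> \<subseteq> lower_sets M"
    then have "?h (\<Sqinter>\<^bsub>Id_frame M\<^esub>\<F>) = lower_closure N (f ` (carrier M \<inter> \<Inter>\<F>))"
      by (simp only: inf_Id_frame restrict_apply lower_sets_Inter if_True)
    also have "\<dots> = \<Sqinter>\<^bsub>Id_frame N\<^esub>(?h ` \<F>)"
      using \<F> by (simp only: img img_low inf_Id_frame lower_closure_image_Inter)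
    finally show "?h (\<Sqinter>\<^bsub>Id_frame M\<^esub>\<F>) = \<Sqinter>\<^bsub>Id_frame N\<^esub>(?h ` \<F>)" .
  qed
  moreover have "sup_pres (Id_frame M) (Id_frame N) ?h"
    unfolding sup_pres_def carrier_Id_frame
  proof (intro conjI allI impI)
    fix \<S> assume \<S>: "\<S> \<subseteq> lower_sets M"
    then have "?h (\<Squnion>\<^bsub>Id_frame M\<^esub>\<S>) = lower_closure N (f ` \<Union>\<S>)"
      by (simp only: sup_Id_frame restrict_apply lower_sets_Union if_True)
    also have "\<dots> = \<Squnion>\<^bsub>Id_frame N\<^esub>(?h ` \<S>)"
      using \<S> by (simp only: img img_low sup_Id_frame image_Union lower_closure_Union image_image)
    finally show "?h (\<Squnion>\<^bsub>Id_frame M\<^esub>\<S>) = \<Squnion>\<^bsub>Id_frame N\<^esub>(?h ` \<S>)" .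
  qed (rule Id_M.complete_lattice_axioms Id_N.complete_lattice_axioms)+
  moreover have "supercompact (Id_frame N) (?h S)" if "supercompact (Id_frame M) S" for S
    using that mslat_hom_closed[OF f]
    by (auto simp: M.supercompact_Id_frame_iff N.supercompact_Id_frame_iff
        M.principal_ideal_lower_set lower_closure_image_principal_ideal)
  ultimately show ?thesis
    by (simp add: sc_frame_hom_def frame_hom_def)
qed

end

lemma A_map_compose:
  assumes N: "meet_semilattice N" and P: "meet_semilattice P"
    and f: "f \<in> mslat_hom M N" and g: "g \<in> mslat_hom N P" and S: "S \<in> lower_sets M"
  shows "lower_closure P (compose (carrier M) g f ` S) = lower_closure P (g ` lower_closure N (f ` S))"
proof
  interpret N: meet_semilattice N
    by (rule N)
  interpret P: meet_semilattice P
    by (rule P)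
  have SM: "S \<subseteq> carrier M"
    using S by (simp add: lower_sets_def)
  then have img: "compose (carrier M) g f ` S = g ` f ` S"
    by (force simp: compose_def)
  have fS: "f ` S \<subseteq> carrier N"
    using SM mslat_hom_closed[OF f] by blast
  then have "f ` S \<subseteq> lower_closure N (f ` S)"
    using N.le_refl unfolding lower_closure_def by blast
  then show "lower_closure P (compose (carrier M) g f ` S) \<subseteq>
      lower_closure P (g ` lower_closure N (f ` S))"
    unfolding img by (intro lower_closure_mono image_mono)
  show "lower_closure P (g ` lower_closure N (f ` S)) \<subseteq>
      lower_closure P (compose (carrier M) g f ` S)"
  proof
    fix z assume "z \<in> lower_closure P (g ` lower_closure N (f ` S))"
    then obtain y x where z: "z \<in> carrier P" "z \<sqsubseteq>\<^bsub>P\<^esub> g y"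
      and y: "y \<in> carrier N" "y \<sqsubseteq>\<^bsub>N\<^esub> f x" and x: "x \<in> S"
      by (auto simp: lower_closure_def)
    have fx: "f x \<in> carrier N"
      using x fS by blast
    have "g y \<sqsubseteq>\<^bsub>P\<^esub> g (f x)"
      by (rule mslat_hom_mono[OF g N P y(1) fx y(2)])
    then have "z \<sqsubseteq>\<^bsub>P\<^esub> g (f x)"
      by (rule P.le_trans[OF z(2) _ z(1) mslat_hom_closed[OF g y(1)] mslat_hom_closed[OF g fx]])
    with z(1) x show "z \<in> lower_closure P (compose (carrier M) g f ` S)"
      unfolding img by (auto simp: lower_closure_def)
  qed
qed

lemma is_functor_A:
  assumes K: "\<And>M. M \<in> MSLat_obj K \<Longrightarrow> lower_sets M \<in> K'"
  shows "is_functor (opposite (MSLat K)) (SCLoc K') A_functor"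
  unfolding MSLat_eq SCLoc_eq
proof (rule contravariant_functorI[OF concrete_cat_MSLat concrete_cat_SCFrm])
  show "ObjMap A_functor M \<in> SCFrm_obj K'" if "M \<in> MSLat_obj K" for M
    using that K[OF that] meet_semilattice.has_supercompact_basis_Id_frame[of M]
    by (simp add: A_functor_def SCFrm_obj_def MSLat_obj_def frame_Id_frame carrier_Id_frame)
  show "ArrMap A_functor N M f \<in> sc_frame_hom (ObjMap A_functor M) (ObjMap A_functor N)"
    if "M \<in> MSLat_obj K" "N \<in> MSLat_obj K" "f \<in> mslat_hom M N" for M N f
    using that by (simp add: A_functor_def MSLat_obj_def A_map_sc_frame_hom)
  show "ArrMap A_functor M M (\<lambda>x\<in>carrier M. x) S = S"
    if "M \<in> MSLat_obj K" "S \<in> carrier (ObjMap A_functor M)" for M S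
  proof -
    interpret meet_semilattice M
      using that(1) by (simp add: MSLat_obj_def)
    have S: "S \<in> lower_sets M"
      using that(2) by (simp add: A_functor_def carrier_Id_frame)
    then have "(\<lambda>x\<in>carrier M. x) ` S = S"
      by (force simp: lower_sets_def)
    with S show ?thesis
      by (simp add: A_functor_def lower_closure_id partial_order_axioms)
  qed
  show "ArrMap A_functor P M (compose (carrier M) g f) S =
      ArrMap A_functor P N g (ArrMap A_functor N M f S)"
    if "M \<in> MSLat_obj K" "N \<in> MSLat_obj K" "P \<in> MSLat_obj K"
      "f \<in> mslat_hom M N" "g \<in> mslat_hom N P" "S \<in> carrier (ObjMap A_functor M)" for M N P f g S
  proof -
    have S: "S \<in> lower_sets M"
      using that(6) by (simp add: A_functor_def carrier_Id_frame)
    have ms: "meet_semilattice M" "meet_semilattice N" "meet_semilattice P"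
      using that by (simp_all add: MSLat_obj_def)
    show ?thesis
      using A_map_compose[OF ms(2,3) that(4,5) S] S
        lower_closure_image_lower_set[OF ms(1,2) that(4) S]
      by (simp add: A_functor_def)
  qed
qed

section \<open>The semilattice of supercompact elements\<close>

locale sc_frame = frame L for L :: "'a gorder" (structure) +
  assumes supercompact_basis: "has_supercompact_basis L"
begin

abbreviation I :: "'a gorder" where
  "I \<equiv> L\<lparr>carrier := supercompacts L\<rparr>"

lemma obtains_supercompact_join:
  assumes "x \<in> carrier L"
  obtains S where "S \<subseteq> supercompacts L" "x = \<Squnion>S"
proof -
  obtain B where B: "is_basis L B" "B \<subseteq> supercompacts L"
    using supercompact_basis unfolding has_supercompact_basis_def by (elim exE conjE)
  have "\<exists>S. S \<subseteq> B \<and> x = \<Squnion>S"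
    using B(1) assms by (simp only: is_basis_def)
  with B(2) that show ?thesis
    by (elim exE conjE) (metis subset_trans)
qed

text \<open>
  A supercompact element is a join of elements of the given basis, hence one of them, so the basis
  contains every supercompact element and its closure under finite meets is inherited.
\<close>

lemma supercompacts_finite_inf:
  assumes F: "finite F" "F \<subseteq> supercompacts L"
  shows "\<Sqinter>F \<in> supercompacts L"
proof -
  obtain B where B: "is_basis L B" "B \<subseteq> supercompacts L" "finite_meet_closed L B"
    using supercompact_basis unfolding has_supercompact_basis_def by (elim exE conjE)
  have "a \<in> B" if a: "a \<in> supercompacts L" for a
  proof -
    have "\<exists>S. S \<subseteq> B \<and> a = \<Squnion>S"
      using B(1) subsetD[OF supercompacts_closed a] by (simp only: is_basis_def)
    then obtain S where S: "S \<subseteq> B" "a = \<Squnion>S"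
      by (elim exE conjE)
    have "S \<subseteq> carrier L"
      by (rule subset_trans[OF S(1) subset_trans[OF B(2) supercompacts_closed]])
    then have "a \<in> S"
      by (rule supercompactD[OF a _ S(2)])
    with S(1) show ?thesis
      by (rule subsetD)
  qed
  then have "F \<subseteq> B"
    using F(2) by (meson subset_iff)
  with F(1) have "\<Sqinter>F \<in> B"
    using B(3)[unfolded finite_meet_closed_def, rule_format, OF conjI] by blast
  with B(2) show ?thesis
    by (rule subsetD)
qed

lemma partial_order_I: "partial_order I"
proof -
  have "weak_partial_order I"
    by (rule weak_partial_order_subset[OF weak_partial_order_axioms supercompacts_closed])
  then show ?thesis
    by (simp add: partial_order_def partial_order_axioms_def eq_is_equal)
qed

lemma is_glb_I:
  assumes F: "finite F" "F \<subseteq> supercompacts L"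
  shows "is_glb I (\<Sqinter>F) F"
proof (rule greatest_LowerI)
  have FL: "F \<subseteq> carrier L"
    by (rule subset_trans[OF F(2) supercompacts_closed])
  show "F \<subseteq> carrier I" "\<Sqinter>F \<in> carrier I"
    using F(2) supercompacts_finite_inf[OF F] by simp_all
  show "\<Sqinter>F \<sqsubseteq>\<^bsub>I\<^esub> x" if "x \<in> F" for x
    using inf_lower[OF FL that] by simp
  show "y \<sqsubseteq>\<^bsub>I\<^esub> \<Sqinter>F" if "y \<in> Lower I F" for y
  proof -
    have "y \<in> carrier L"
      using that subsetD[OF supercompacts_closed, of y L] by (simp add: Lower_def)
    moreover have "y \<sqsubseteq> x" if "x \<in> F" for x
      using Lower_memD[OF \<open>y \<in> Lower I F\<close> that] F(2) by simp
    ultimately show ?thesis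
      using inf_greatest[OF FL] by simp
  qed
qed

lemma inf_I: "finite F \<Longrightarrow> F \<subseteq> supercompacts L \<Longrightarrow> \<Sqinter>\<^bsub>I\<^esub>F = \<Sqinter>F"
  by (rule partial_order.inf_eqI[OF partial_order_I is_glb_I])

lemma meet_semilattice_I: "meet_semilattice I"
proof -
  interpret I: partial_order I
    by (rule partial_order_I)
  show ?thesis
  proof
    show "\<exists>s. is_glb I s {x, y}" if "x \<in> carrier I" "y \<in> carrier I" for x y
      by (rule exI, rule is_glb_I) (use that in simp_all)
    show "\<exists>x. greatest I x (carrier I)"
      using is_glb_I[OF finite.emptyI empty_subsetI] unfolding Lower_empty by (rule exI)
  qed
qed

text \<open>
  Supercompact elements are completely join prime: if \<open>a \<sqsubseteq> \<Squnion>S\<close>, then \<open>a = a \<sqinter> \<Squnion>S\<close> is the join of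
  the elements \<open>a \<sqinter> s\<close>, hence equal to one of them.
\<close>

lemma supercompact_le_sup:
  assumes a: "a \<in> supercompacts L" and S: "S \<subseteq> carrier L" and le: "a \<sqsubseteq> \<Squnion>S"
  obtains s where "s \<in> S" "a \<sqsubseteq> s"
proof -
  have aL: "a \<in> carrier L"
    by (rule subsetD[OF supercompacts_closed a])
  have "a = a \<sqinter> \<Squnion>S"
    by (rule iffD1[OF le_iff_join[OF aL sup_closed[OF S]] le])
  also have "\<dots> = \<Squnion>((\<lambda>s. a \<sqinter> s) ` S)"
    by (rule meet_sup_distrib[OF aL S])
  finally have "a \<in> (\<lambda>s. a \<sqinter> s) ` S"
    by (rule supercompactD[OF a, rotated]) (intro image_subsetI meet_closed[OF aL] subsetD[OF S])
  then obtain s where s: "s \<in> S" "a = a \<sqinter> s"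
    by (rule imageE)
  from s(2) have "a \<sqsubseteq> s"
    by (rule iffD2[OF le_iff_join[OF aL subsetD[OF S s(1)]]])
  with s(1) show ?thesis
    by (rule that)
qed

lemma lower_sets_I_closed: "S \<in> lower_sets I \<Longrightarrow> S \<subseteq> carrier L"
  using supercompacts_closed[of L] by (auto simp: lower_sets_def)

lemma sup_lower_closure:
  assumes T: "T \<subseteq> supercompacts L"
  shows "\<Squnion>(lower_closure I T) = \<Squnion>T"
proof (rule le_antisym)
  have TL: "T \<subseteq> carrier L"
    by (rule subset_trans[OF T supercompacts_closed])
  have CL: "lower_closure I T \<subseteq> carrier L"
    using supercompacts_closed[of L] by (auto simp: lower_closure_def)
  show "\<Squnion>(lower_closure I T) \<sqsubseteq> \<Squnion>T"
  proof (rule sup_least[OF CL sup_closed[OF TL]])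
    fix y assume "y \<in> lower_closure I T"
    then obtain x where x: "x \<in> T" "y \<sqsubseteq> x" and y: "y \<in> carrier L"
      using CL by (auto simp: lower_closure_def)
    show "y \<sqsubseteq> \<Squnion>T"
      by (rule le_trans[OF x(2) sup_upper[OF TL x(1)] y subsetD[OF TL x(1)] sup_closed[OF TL]])
  qed
  show "\<Squnion>T \<sqsubseteq> \<Squnion>(lower_closure I T)"
  proof (rule sup_least[OF TL sup_closed[OF CL]])
    fix x assume x: "x \<in> T"
    then have "x \<in> lower_closure I T"
      using subsetD[OF T x] le_refl[OF subsetD[OF TL x]] by (auto simp: lower_closure_def)
    then show "x \<sqsubseteq> \<Squnion>(lower_closure I T)"
      by (rule sup_upper[OF CL])
  qed
  show "\<Squnion>(lower_closure I T) \<in> carrier L" "\<Squnion>T \<in> carrier L"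
    using CL TL by simp_all
qed

text \<open>
  Primeness shows that \<open>\<Squnion>S \<sqsubseteq> \<Squnion>T\<close> forces \<open>S \<subseteq> T\<close>; surjectivity is the basis property, with the lower
  closure replacing an arbitrary set of supercompact elements by a lower set with the same join.
\<close>

lemma order_iso_sup_supercompacts: "order_iso (Id_frame I) L (\<lambda>S. \<Squnion>S)"
proof -
  have le: "\<Squnion>S \<sqsubseteq> \<Squnion>T \<longleftrightarrow> S \<subseteq> T" if S: "S \<in> lower_sets I" and T: "T \<in> lower_sets I" for S T
  proof
    have SL: "S \<subseteq> carrier L" and TL: "T \<subseteq> carrier L"
      using S T by (simp_all add: lower_sets_I_closed)
    show "\<Squnion>S \<sqsubseteq> \<Squnion>T" if "S \<subseteq> T"
      by (rule sup_least[OF SL sup_closed[OF TL]]) (rule sup_upper[OF TL subsetD[OF that]])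
    show "S \<subseteq> T" if ST: "\<Squnion>S \<sqsubseteq> \<Squnion>T"
    proof
      fix a assume a: "a \<in> S"
      then have a_sc: "a \<in> supercompacts L"
        using S by (auto simp: lower_sets_def)
      have "a \<sqsubseteq> \<Squnion>T"
        by (rule le_trans[OF sup_upper[OF SL a] ST subsetD[OF SL a] sup_closed[OF SL]
              sup_closed[OF TL]])
      with a_sc TL obtain t where "t \<in> T" "a \<sqsubseteq> t"
        by (rule supercompact_le_sup)
      with a_sc T show "a \<in> T"
        by (auto simp: lower_sets_def)
    qed
  qed
  have "(\<lambda>S. \<Squnion>S) ` lower_sets I = carrier L"
  proof
    show "(\<lambda>S. \<Squnion>S) ` lower_sets I \<subseteq> carrier L"
      by (intro image_subsetI sup_closed lower_sets_I_closed)
    show "carrier L \<subseteq> (\<lambda>S. \<Squnion>S) ` lower_sets I"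
    proof
      fix x assume "x \<in> carrier L"
      then obtain S where S: "S \<subseteq> supercompacts L" "x = \<Squnion>S"
        by (rule obtains_supercompact_join)
      have "lower_closure I S \<in> lower_sets I"
        using S(1) by (intro lower_closure_lower_set partial_order_I) simp
      moreover have "x = \<Squnion>(lower_closure I S)"
        using S(2) sup_lower_closure[OF S(1)] by (simp only:)
      ultimately show "x \<in> (\<lambda>S. \<Squnion>S) ` lower_sets I"
        by (rule rev_image_eqI)
    qed
  qed
  moreover have "inj_on (\<lambda>S. \<Squnion>S) (lower_sets I)"
  proof (rule inj_onI)
    fix S T assume ST: "S \<in> lower_sets I" "T \<in> lower_sets I" "\<Squnion>S = \<Squnion>T"
    have "\<Squnion>S \<sqsubseteq> \<Squnion>T" "\<Squnion>T \<sqsubseteq> \<Squnion>S"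
      using le_refl[OF sup_closed[OF lower_sets_I_closed[OF ST(1)]]] ST(3) by simp_all
    then show "S = T"
      by (intro subset_antisym) (simp_all only: le[OF ST(1,2)] le[OF ST(2,1)])
  qed
  ultimately show ?thesis
    by (simp add: order_iso_def bij_betw_def carrier_Id_frame le_Id_frame le)
qed

end

lemma SCFrm_obj_sc_frame: "L \<in> SCFrm_obj K \<Longrightarrow> sc_frame L"
  by (simp add: SCFrm_obj_def sc_frame_def sc_frame_axioms_def)

lemma sc_frame_hom_supercompacts:
  "f \<in> sc_frame_hom L L' \<Longrightarrow> a \<in> supercompacts L \<Longrightarrow> f a \<in> supercompacts L'"
  by (simp add: sc_frame_hom_def supercompacts_def)

lemma I_map_mslat_hom:
  assumes L: "sc_frame L" and L': "sc_frame L'" and f: "f \<in> sc_frame_hom L L'"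
  shows "restrict f (supercompacts L) \<in>
    mslat_hom (L\<lparr>carrier := supercompacts L\<rparr>) (L'\<lparr>carrier := supercompacts L'\<rparr>)"
proof -
  interpret L: sc_frame L
    by (rule L)
  interpret L': sc_frame L'
    by (rule L')
  have "restrict f (supercompacts L) (\<Sqinter>\<^bsub>L.I\<^esub>F) = \<Sqinter>\<^bsub>L'.I\<^esub>(restrict f (supercompacts L) ` F)"
    if F: "finite F" "F \<subseteq> supercompacts L" for F
  proof -
    have img: "restrict f (supercompacts L) ` F = f ` F"
      using F(2) by (intro image_cong) auto
    have "f ` F \<subseteq> supercompacts L'"
      using F sc_frame_hom_supercompacts[OF f] by blast
    moreover have "f (\<Sqinter>\<^bsub>L\<^esub>F) = \<Sqinter>\<^bsub>L'\<^esub>(f ` F)"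
      by (rule sc_frame_hom_inf[OF f F(1) subset_trans[OF F(2) supercompacts_closed]])
    ultimately show ?thesis
      using F by (simp only: img L.inf_I L'.inf_I finite_imageI restrict_apply
          L.supercompacts_finite_inf if_True)
  qed
  then show ?thesis
    using sc_frame_hom_supercompacts[OF f] by (auto simp: mslat_hom_def finite_meet_pres_def)
qed

lemma is_functor_I:
  assumes K: "\<And>L. L \<in> SCFrm_obj K \<Longrightarrow> supercompacts L \<in> K'"
  shows "is_functor (SCLoc K) (opposite (MSLat K')) I_functor"
  unfolding MSLat_eq SCLoc_eq
proof (rule contravariant_functorI[OF concrete_cat_SCFrm concrete_cat_MSLat])
  show "ObjMap I_functor L \<in> MSLat_obj K'" if "L \<in> SCFrm_obj K" for L
    using K[OF that] sc_frame.meet_semilattice_I[OF SCFrm_obj_sc_frame[OF that]]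
    by (simp add: I_functor_def MSLat_obj_def)
  show "ArrMap I_functor L' L f \<in> mslat_hom (ObjMap I_functor L) (ObjMap I_functor L')"
    if "L \<in> SCFrm_obj K" "L' \<in> SCFrm_obj K" "f \<in> sc_frame_hom L L'" for L L' f
    using I_map_mslat_hom[OF SCFrm_obj_sc_frame[OF that(1)] SCFrm_obj_sc_frame[OF that(2)] that(3)]
    by (simp add: I_functor_def)
  show "ArrMap I_functor L L (\<lambda>x\<in>carrier L. x) x = x"
    if "L \<in> SCFrm_obj K" "x \<in> carrier (ObjMap I_functor L)" for L x
    using that supercompacts_closed[of L] by (auto simp: I_functor_def)
  show "ArrMap I_functor L3 L1 (compose (carrier L1) g f) x =
      ArrMap I_functor L3 L2 g (ArrMap I_functor L2 L1 f x)"
    if "f \<in> sc_frame_hom L1 L2" "x \<in> carrier (ObjMap I_functor L1)" for L1 L2 L3 f g x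
    using that supercompacts_closed[of L1] sc_frame_hom_supercompacts[OF that(1)]
    by (auto simp: I_functor_def compose_def)
qed

text \<open>
  Naturality of \<open>S \<mapsto> \<Squnion>S\<close>: joins are preserved by \<open>f\<close>, and closing downwards does not change them.
\<close>

lemma sup_lower_closure_image:
  assumes L: "sc_frame L" and L': "sc_frame L'" and f: "f \<in> sc_frame_hom L L'"
    and S: "S \<in> lower_sets (L\<lparr>carrier := supercompacts L\<rparr>)"
  shows "\<Squnion>\<^bsub>L'\<^esub>(lower_closure (L'\<lparr>carrier := supercompacts L'\<rparr>) (restrict f (supercompacts L) ` S)) =
    f (\<Squnion>\<^bsub>L\<^esub>S)"
proof -
  have S_sc: "S \<subseteq> supercompacts L"
    using S by (simp add: lower_sets_def)
  then have img: "restrict f (supercompacts L) ` S = f ` S"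
    by (intro image_cong) auto
  have "f ` S \<subseteq> supercompacts L'"
    using S_sc sc_frame_hom_supercompacts[OF f] by blast
  then show ?thesis
    using sc_frame_hom_sup[OF f sc_frame.lower_sets_I_closed[OF L S]]
    by (simp only: img sc_frame.sup_lower_closure[OF L'])
qed

section \<open>The duality\<close>

lemma natural_iso_relabel_principal_ideal:
  fixes e :: "'a \<Rightarrow> 'a set"
  assumes e: "inj e"
  shows "naturally_isomorphic (opposite (MSLat UNIV)) (opposite (MSLat UNIV))
    (relabel_functor e) (I_functor \<circ>\<^sub>F A_functor)"
proof -
  have inj: "inj_on e X" for X
    using e by (rule inj_on_subset) simp
  have "is_functor (opposite (MSLat UNIV)) (opposite (MSLat UNIV)) (relabel_functor e)"
    by (rule is_functor_relabel_MSLat) (simp_all add: inj)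
  moreover have "is_functor (opposite (MSLat UNIV)) (opposite (MSLat UNIV))
      (I_functor \<circ>\<^sub>F (A_functor :: ('a gorder, 'a \<Rightarrow> 'a, 'a set gorder, 'a set \<Rightarrow> 'a set) functor_data))"
    by (rule is_functor_comp[OF is_functor_A[where K' = UNIV] is_functor_I]) simp_all
  ultimately show ?thesis
    unfolding MSLat_eq
  proof (rule naturally_isomorphicI[OF concrete_cat_MSLat concrete_cat_MSLat])
    show "order_iso (ObjMap (relabel_functor e) M) (ObjMap (I_functor \<circ>\<^sub>F A_functor) M)
        (\<lambda>y. principal_ideal M (inv_into (carrier M) e y))"
      if "M \<in> MSLat_obj UNIV" for M
    proof -
      interpret meet_semilattice M
        using that by (simp add: MSLat_obj_def)
      show ?thesis
        using order_iso_comp[OF order_iso_inv[OF order_iso_relabel[OF inj]] order_iso_principal_ideal]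
        by (simp add: relabel_functor_def comp_functor_def I_functor_def A_functor_def)
    qed
    show "principal_ideal N (inv_into (carrier N) e (ArrMap (relabel_functor e) N M f y)) =
        ArrMap (I_functor \<circ>\<^sub>F A_functor) N M f (principal_ideal M (inv_into (carrier M) e y))"
      if M: "M \<in> MSLat_obj UNIV" and N: "N \<in> MSLat_obj UNIV" and f: "f \<in> mslat_hom M N"
        and y: "y \<in> carrier (ObjMap (relabel_functor e) M)" for M N f y
    proof -
      have ms: "meet_semilattice M" "meet_semilattice N"
        using M N by (simp_all add: MSLat_obj_def)
      then interpret M: meet_semilattice M
        by simp
      obtain x where x: "x \<in> carrier M" "y = e x"
        using y by (auto simp: relabel_functor_def carrier_relabel)
      have "f x \<in> carrier N"
        by (rule mslat_hom_closed[OF f x(1)])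
      then show ?thesis
        using x lower_closure_image_principal_ideal[OF ms f x(1)] M.principal_ideal_lower_set[OF x(1)]
        by (simp add: relabel_functor_def relabel_map_eq inj inv_into_f_f comp_functor_def
            I_functor_def A_functor_def M.supercompacts_Id_frame)
    qed
  qed
qed

lemma natural_iso_sup_relabel:
  fixes e :: "'a \<Rightarrow> 'a set"
  assumes e: "inj e"
  shows "naturally_isomorphic (SCLoc UNIV) (SCLoc UNIV)
    (A_functor \<circ>\<^sub>F I_functor) (relabel_functor e)"
proof -
  have inj: "inj_on e X" for X
    using e by (rule inj_on_subset) simp
  have "is_functor (SCLoc UNIV) (SCLoc UNIV)
      (A_functor \<circ>\<^sub>F (I_functor :: ('a gorder, 'a \<Rightarrow> 'a, 'a gorder, 'a \<Rightarrow> 'a) functor_data))"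
    by (rule is_functor_comp[OF is_functor_I[where K' = UNIV] is_functor_A]) simp_all
  moreover have "is_functor (SCLoc UNIV) (SCLoc UNIV) (relabel_functor e)"
    by (rule is_functor_relabel_SCLoc) (simp_all add: inj)
  ultimately show ?thesis
    unfolding SCLoc_eq
  proof (rule naturally_isomorphicI[OF concrete_cat_SCFrm concrete_cat_SCFrm])
    show "order_iso (ObjMap (A_functor \<circ>\<^sub>F I_functor) L) (ObjMap (relabel_functor e) L)
        (\<lambda>S. e (\<Squnion>\<^bsub>L\<^esub>S))"
      if "L \<in> SCFrm_obj UNIV" for L
      using order_iso_comp[OF sc_frame.order_iso_sup_supercompacts[OF SCFrm_obj_sc_frame[OF that]]
          order_iso_relabel[OF inj]]
      by (simp add: relabel_functor_def comp_functor_def I_functor_def A_functor_def)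
    show "e (\<Squnion>\<^bsub>L'\<^esub>(ArrMap (A_functor \<circ>\<^sub>F I_functor) L' L f S)) =
        ArrMap (relabel_functor e) L' L f (e (\<Squnion>\<^bsub>L\<^esub>S))"
      if L: "L \<in> SCFrm_obj UNIV" and L': "L' \<in> SCFrm_obj UNIV" and f: "f \<in> sc_frame_hom L L'"
        and S: "S \<in> carrier (ObjMap (A_functor \<circ>\<^sub>F I_functor) L)" for L L' f S
    proof -
      note sc = SCFrm_obj_sc_frame[OF L] SCFrm_obj_sc_frame[OF L']
      interpret L: sc_frame L
        by (rule sc(1))
      have S': "S \<in> lower_sets L.I"
        using S by (simp add: comp_functor_def I_functor_def A_functor_def carrier_Id_frame)
      have "\<Squnion>\<^bsub>L\<^esub>S \<in> carrier L"
        by (rule L.sup_closed[OF L.lower_sets_I_closed[OF S']])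
      then show ?thesis
        using S' sup_lower_closure_image[OF sc f S']
        by (simp add: relabel_functor_def relabel_map_eq inj comp_functor_def I_functor_def
            A_functor_def)
    qed
  qed
qed

text \<open>
  The intermediate category of frames of lower sets lives over \<open>'u set\<close>.  Its carriers are restricted
  to the sets \<open>lower_sets M\<close> with \<open>M\<close> small, because \<open>code\<close> is injective only on small sets; a lower
  set of a small \<open>M\<close> is small, as a subset of a small set.
\<close>

lemma duality_in_universe:
  fixes K :: "'u set set" and code :: "'u set \<Rightarrow> 'u"
  assumes "universe K code"
  shows "duality (MSLat K) (SCLoc K) (relabel_functor code \<circ>\<^sub>F A_functor) I_functor"
proof -
  have code: "inj_on code K"
    and subset: "\<And>X Y. X \<in> K \<Longrightarrow> Y \<subseteq> X \<Longrightarrow> Y \<in> K"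
    and power: "\<And>X. X \<in> K \<Longrightarrow> code ` Pow X \<in> K"
    using assms by (auto simp: universe_def)
  have code_low: "inj_on code (lower_sets M)" if "carrier M \<in> K" for M
    by (rule inj_on_subset[OF code]) (use that subset in \<open>auto simp: lower_sets_def\<close>)
  have code_K: "code ` lower_sets M \<in> K" if "carrier M \<in> K" for M
    by (rule subset[OF power[OF that]]) (auto simp: lower_sets_def)
  let ?F = "relabel_functor code \<circ>\<^sub>F A_functor"
  have A: "is_functor (opposite (MSLat K)) (SCLoc (lower_sets ` MSLat_obj K)) A_functor"
    by (rule is_functor_A) simp
  have R: "is_functor (SCLoc (lower_sets ` MSLat_obj K)) (SCLoc K) (relabel_functor code)"
    by (rule is_functor_relabel_SCLoc) (auto simp: MSLat_obj_def code_low code_K)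
  have F: "is_functor (opposite (MSLat K)) (SCLoc K) ?F"
    by (rule is_functor_comp[OF A R])
  have I: "is_functor (SCLoc K) (opposite (MSLat K)) I_functor"
    by (rule is_functor_I, rule subset[OF _ supercompacts_closed]) (simp add: SCFrm_obj_def)
  have "is_functor (opposite (MSLat K)) (opposite (MSLat K)) id_functor"
    by (rule is_functor_id[OF is_functor.axioms(1)[OF F]])
  then have "naturally_isomorphic (opposite (MSLat K)) (opposite (MSLat K)) id_functor (I_functor \<circ>\<^sub>F ?F)"
    using is_functor_comp[OF F I] unfolding MSLat_eq
  proof (rule naturally_isomorphicI[OF concrete_cat_MSLat concrete_cat_MSLat])
    have iso: "order_iso (Id_frame M\<lparr>carrier := supercompacts (Id_frame M)\<rparr>)
        (relabel code (Id_frame M)\<lparr>carrier := supercompacts (relabel code (Id_frame M))\<rparr>) code"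
      if "M \<in> MSLat_obj K" for M
    proof -
      have inj: "inj_on code (carrier (Id_frame M))"
        using that by (simp add: MSLat_obj_def carrier_Id_frame code_low)
      interpret Id_M: frame "Id_frame M"
        by (rule frame_Id_frame)
      interpret code_M: frame "relabel code (Id_frame M)"
        by (rule relabel_frame[OF inj frame_Id_frame])
      show ?thesis
        by (rule order_iso_restrict_supercompacts[OF order_iso_relabel[OF inj]
              Id_M.complete_lattice_axioms code_M.complete_lattice_axioms])
    qed
    show "order_iso (ObjMap id_functor M) (ObjMap (I_functor \<circ>\<^sub>F ?F) M)
        (\<lambda>x. code (principal_ideal M x))"
      if M: "M \<in> MSLat_obj K" for M
    proof -
      interpret meet_semilattice M
        using M by (simp add: MSLat_obj_def)
      show ?thesis
        using order_iso_comp[OF order_iso_principal_ideal iso[OF M]]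
        by (simp add: id_functor_def relabel_functor_def comp_functor_def I_functor_def A_functor_def)
    qed
    show "code (principal_ideal N (ArrMap id_functor N M f x)) =
        ArrMap (I_functor \<circ>\<^sub>F ?F) N M f (code (principal_ideal M x))"
      if M: "M \<in> MSLat_obj K" and N: "N \<in> MSLat_obj K" and f: "f \<in> mslat_hom M N"
        and x: "x \<in> carrier (ObjMap id_functor M)" for M N f x
    proof -
      have ms: "meet_semilattice M" "meet_semilattice N"
        using M N by (simp_all add: MSLat_obj_def)
      then interpret M: meet_semilattice M
        by simp
      have x': "x \<in> carrier M"
        using x by (simp add: id_functor_def)
      have "code (principal_ideal M x) \<in> supercompacts (relabel code (Id_frame M))"
        using order_iso_closed[OF iso[OF M], of "principal_ideal M x"] x'
        by (simp add: M.supercompacts_Id_frame)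
      moreover have "inj_on code (carrier (Id_frame M))"
        using M by (simp add: MSLat_obj_def carrier_Id_frame code_low)
      ultimately show ?thesis
        using lower_closure_image_principal_ideal[OF ms f x'] M.principal_ideal_lower_set[OF x']
        by (simp add: id_functor_def relabel_functor_def relabel_map_eq carrier_Id_frame
            comp_functor_def I_functor_def A_functor_def)
    qed
  qed
  moreover have "naturally_isomorphic (SCLoc K) (SCLoc K) (?F \<circ>\<^sub>F I_functor) id_functor"
    using is_functor_comp[OF I F] is_functor_id[OF is_functor.axioms(1)[OF I]] unfolding SCLoc_eq
  proof (rule naturally_isomorphicI[OF concrete_cat_SCFrm concrete_cat_SCFrm])
    have inj: "inj_on code (lower_sets (L\<lparr>carrier := supercompacts L\<rparr>))" if "L \<in> SCFrm_obj K" for L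
      using that subset[OF _ supercompacts_closed] by (simp add: code_low SCFrm_obj_def)
    show "order_iso (ObjMap (?F \<circ>\<^sub>F I_functor) L) (ObjMap id_functor L)
        (\<lambda>y. \<Squnion>\<^bsub>L\<^esub>(inv_into (lower_sets (L\<lparr>carrier := supercompacts L\<rparr>)) code y))"
      if L: "L \<in> SCFrm_obj K" for L
    proof -
      interpret sc_frame L
        by (rule SCFrm_obj_sc_frame[OF L])
      have "inj_on code (carrier (Id_frame I))"
        using inj[OF L] by (simp add: carrier_Id_frame)
      from order_iso_comp[OF order_iso_inv[OF order_iso_relabel[OF this]]
          order_iso_sup_supercompacts]
      show ?thesis
        by (simp add: id_functor_def relabel_functor_def comp_functor_def I_functor_def
            A_functor_def carrier_Id_frame)
    qed
    show "\<Squnion>\<^bsub>L'\<^esub>(inv_into (lower_sets (L'\<lparr>carrier := supercompacts L'\<rparr>)) code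
          (ArrMap (?F \<circ>\<^sub>F I_functor) L' L f y)) =
        ArrMap id_functor L' L f
          (\<Squnion>\<^bsub>L\<^esub>(inv_into (lower_sets (L\<lparr>carrier := supercompacts L\<rparr>)) code y))"
      if L: "L \<in> SCFrm_obj K" and L': "L' \<in> SCFrm_obj K" and f: "f \<in> sc_frame_hom L L'"
        and y: "y \<in> carrier (ObjMap (?F \<circ>\<^sub>F I_functor) L)" for L L' f y
    proof -
      note sc = SCFrm_obj_sc_frame[OF L] SCFrm_obj_sc_frame[OF L']
      interpret L: sc_frame L
        by (rule sc(1))
      interpret L': sc_frame L'
        by (rule sc(2))
      obtain S where S: "S \<in> lower_sets L.I" "y = code S"
        using y by (auto simp: relabel_functor_def comp_functor_def I_functor_def A_functor_def
            carrier_relabel carrier_Id_frame)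
      have "lower_closure L'.I (restrict f (supercompacts L) ` S) \<in> lower_sets L'.I"
        by (rule lower_closure_image_lower_set[OF L.meet_semilattice_I L'.meet_semilattice_I
              I_map_mslat_hom[OF sc f] S(1)])
      then show ?thesis
        using S sup_lower_closure_image[OF sc f S(1)] inj[OF L] inj[OF L']
        by (simp add: id_functor_def relabel_functor_def relabel_map_eq carrier_Id_frame
            comp_functor_def I_functor_def A_functor_def inv_into_f_f)
    qed
  qed
  ultimately show ?thesis
    using F I by (simp add: duality_def equivalence_of_categories_def)
qed

theorem theorem4p6:
  fixes K :: "'u set set" and code :: "'u set \<Rightarrow> 'u"
  shows
    \<comment> \<open>First part: all objects over arbitrary types.  \<open>A_functor\<close> raises the type from \<open>'a\<close> to \<open>'a set\<close>,
      so the identity functors are replaced by the relabelling of elements as singletons.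
      Second part: inside a universe the type need not change, and the duality is literal.\<close>
    "(is_functor (opposite (MSLat (UNIV :: 'a set set))) (SCLoc UNIV) A_functor \<and>
      is_functor (SCLoc (UNIV :: 'b set set)) (opposite (MSLat UNIV)) I_functor \<and>
      naturally_isomorphic (opposite (MSLat (UNIV :: 'a set set))) (opposite (MSLat UNIV))
        (relabel_functor (\<lambda>x. {x})) (I_functor \<circ>\<^sub>F A_functor) \<and>
      naturally_isomorphic (SCLoc (UNIV :: 'b set set)) (SCLoc UNIV)
        (A_functor \<circ>\<^sub>F I_functor) (relabel_functor (\<lambda>x. {x}))) \<and>
     (universe K code \<longrightarrow>
      duality (MSLat K) (SCLoc K) (relabel_functor code \<circ>\<^sub>F A_functor) I_functor)"
proof (intro conjI impI)
  show "is_functor (opposite (MSLat (UNIV :: 'a set set))) (SCLoc UNIV) A_functor"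
    by (rule is_functor_A) simp
  show "is_functor (SCLoc (UNIV :: 'b set set)) (opposite (MSLat UNIV)) I_functor"
    by (rule is_functor_I) simp
  show "naturally_isomorphic (opposite (MSLat (UNIV :: 'a set set))) (opposite (MSLat UNIV))
      (relabel_functor (\<lambda>x. {x})) (I_functor \<circ>\<^sub>F A_functor)"
    by (rule natural_iso_relabel_principal_ideal) (simp add: inj_def)
  show "naturally_isomorphic (SCLoc (UNIV :: 'b set set)) (SCLoc UNIV)
      (A_functor \<circ>\<^sub>F I_functor) (relabel_functor (\<lambda>x. {x}))"
    by (rule natural_iso_sup_relabel) (simp add: inj_def)
  show "universe K code \<Longrightarrow> duality (MSLat K) (SCLoc K) (relabel_functor code \<circ>\<^sub>F A_functor) I_functor"
    by (rule duality_in_universe)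
qed

end
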